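(* Let $m,n>-1/2$ and $0\le|\beta_i|<\alpha_i$, $i=1,2$. Let $X\sim\mathrm{VG}(m,\alpha_1,\beta_1,0)$ and $Y\sim\mathrm{VG}(n,\alpha_2,\beta_2,0)$ be independent, let $Z=X/Y$, and let $\bar F_Z(z)=\mathbb{P}(Z>z)$. 1. Suppose $n>0$. Then, as $z\to\infty$, $$\bar F_Z(z)\sim\frac{\gamma_1^{2m+1}\gamma_2^{2n+1}}{\pi\alpha_1^{2m+2}\alpha_2^{2n}}\,\frac{\Gamma(m+1)\Gamma(n)z^{-1}}{\Gamma(m+1/2)\Gamma(n+1/2)}\,{}_2F_1\bigg(1,m+1;\frac12;\frac{\beta_1^2}{\alpha_1^2}\bigg).$$ 2. Suppose $n=0$. Then, as $z\to\infty$, $$\bar F_Z(z)\sim\frac{2\gamma_1^{2m+1}\gamma_2}{\pi^{3/2}\alpha_1^{2m+2}}\,\frac{\Gamma(m+1)z^{-1}\log(z)}{\Gamma(m+1/2)}\,{}_2F_1\bigg(1,m+1;\frac12;\frac{\beta_1^2}{\alpha_1^2}\bigg).$$ 3. Suppose $-1/2<n<0$. Then, as $z\to\infty$, $$\bar F_Z(z)\sim\frac{\gamma_1^{2m+1}\gamma_2^{2n+1}}{\alpha_1^{2m+2n+2}\sin(-n\pi)}\,\frac{\Gamma(m+n+1)z^{-1-2n}}{(1+2n)\Gamma(m+1/2)\Gamma(n+1/2)}\,{}_2F_1\bigg(n+1,m+n+1;\frac12;\frac{\beta_1^2}{\alpha_1^2}\bigg).$$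
   Context: For $m>-1/2$ and $0\le|\beta|<\alpha$, a random variable $X$ has the variance-gamma distribution $\mathrm{VG}(m,\alpha,\beta,0)$ if it has probability density function $$f_X(x)=\frac{\gamma^{2m+1}}{\sqrt{\pi}(2\alpha)^m\Gamma(m+1/2)}\,\mathrm{e}^{\beta x}|x|^mK_m(\alpha|x|),\quad x\in\mathbb{R},\qquad \gamma^2=\alpha^2-\beta^2,\ \gamma>0,$$ where $K_m(x)=\int_0^\infty \mathrm{e}^{-x\cosh t}\cosh(mt)\,\mathrm{d}t$, $x>0$, is the modified Bessel function of the second kind. Notation: $\gamma_i=\sqrt{\alpha_i^2-\beta_i^2}$, $i=1,2$. ${}_2F_1(a,b;c;x)=\sum_{k=0}^\infty\frac{(a)_k(b)_k}{(c)_k}\frac{x^k}{k!}$ for $|x|<1$, with $(u)_k=u(u+1)\cdots(u+k-1)$. The relation $f(z)\sim g(z)$ means $f(z)/g(z)\to1$ in the stated limit. *)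

theory Defs
  imports "HOL-Probability.Probability" "HOL-Library.Landau_Symbols"
begin

text \<open>Modified Bessel function of the second kind. At \<open>x = 0\<close>, where the integral diverges,
  the value is the default \<open>0\<close>; for the density below this concerns a single point only.\<close>

definition bessel_K :: "real \<Rightarrow> real \<Rightarrow> real" where
  "bessel_K m x = (LBINT t:{0<..}. exp (- x * cosh t) * cosh (m * t))"

definition hyp2F1 :: "real \<Rightarrow> real \<Rightarrow> real \<Rightarrow> real \<Rightarrow> real" where
  "hyp2F1 a b c x =
     (\<Sum>k. pochhammer a k * pochhammer b k / pochhammer c k * (x ^ k / fact k))"

definition vg_gamma :: "real \<Rightarrow> real \<Rightarrow> real" where
  "vg_gamma \<alpha> \<beta> = sqrt (\<alpha>\<^sup>2 - \<beta>\<^sup>2)"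

text \<open>Density of \<open>VG(m, \<alpha>, \<beta>, 0)\<close>, meaningful for \<open>m > -1/2\<close> and \<open>\<bar>\<beta>\<bar> < \<alpha>\<close>.\<close>

definition vg_density :: "real \<Rightarrow> real \<Rightarrow> real \<Rightarrow> real \<Rightarrow> real" where
  "vg_density m \<alpha> \<beta> x =
     vg_gamma \<alpha> \<beta> powr (2 * m + 1) / (sqrt pi * (2 * \<alpha>) powr m * Gamma (m + 1/2))
       * exp (\<beta> * x) * \<bar>x\<bar> powr m * bessel_K m (\<alpha> * \<bar>x\<bar>)"

definition vg_distributed ::
    "'a measure \<Rightarrow> ('a \<Rightarrow> real) \<Rightarrow> real \<Rightarrow> real \<Rightarrow> real \<Rightarrow> bool" where
  "vg_distributed M X m \<alpha> \<beta> \<longleftrightarrow>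
     distributed M lborel X (\<lambda>x. ennreal (vg_density m \<alpha> \<beta> x))"

end

theory Submission
  imports Defs "HOL-Real_Asymp.Real_Asymp"
begin

text \<open>Conditioning on \<open>X\<close> gives \<open>P(X/Y > z) = E Q(X/z)\<close> with \<open>Q(u) = P(u/Y > 1)\<close>, the probability that
  \<open>Y\<close> lies strictly between \<open>0\<close> and \<open>u\<close>. The behaviour of \<open>K\<^sub>n\<close> at the origin shows that \<open>Q(u)\<close> is
  asymptotic to a multiple of \<open>\<bar>u\<bar>\<close>, \<open>\<bar>u\<bar> ln (1/\<bar>u\<bar>)\<close> or \<open>\<bar>u\<bar>\<^bsup>2n+1\<^esup>\<close> as \<open>u \<rightarrow> 0\<close>, according to the sign of
  \<open>n\<close>. As \<open>Q \<le> 1\<close>, the rescaled \<open>Q(X/z)\<close> is dominated by a multiple of \<open>1 + X\<^sup>2\<close>, so the tail is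
  governed by \<open>E\<bar>X\<bar>\<close> or \<open>E\<bar>X\<bar>\<^bsup>2n+1\<^esup>\<close>. These moments are computed from the Mellin transform of \<open>K\<^sub>m\<close> by
  expanding \<open>cosh (\<beta>x)\<close> into its power series, which yields the hypergeometric factor. Both the
  Mellin transform and the asymptotics for \<open>n \<noteq> 0\<close> rest on the representation
  \<open>x\<^bsup>m\<^esup> K\<^sub>m(x) = 2\<^bsup>m-1\<^esup> \<integral> v\<^bsup>m-1\<^esup> exp (-v - x\<^sup>2/(4v)) dv\<close> over \<open>v > 0\<close>.\<close>

section \<open>Change of variables for integrals of nonnegative functions\<close>

text \<open>For a nonnegative integrand gauge integrability is already absolute integrability, so a
  finite extended integral and a gauge integral carry the same information. This is the bridge to
  the change of variables theorem for \<open>absolutely_integrable_on\<close>.\<close>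

lemma set_nn_integral_eq_ennreal_iff:
  fixes f :: "real \<Rightarrow> real"
  assumes [measurable]: "set_borel_measurable borel A f"
    and nonneg: "\<And>x. x \<in> A \<Longrightarrow> 0 \<le> f x" and "b \<ge> 0"
  shows "(\<integral>\<^sup>+x\<in>A. f x \<partial>lborel) = ennreal b \<longleftrightarrow>
    f absolutely_integrable_on A \<and> integral A f = b"
proof
  assume *: "(\<integral>\<^sup>+x\<in>A. f x \<partial>lborel) = ennreal b"
  have "((\<lambda>x. indicator A x *\<^sub>R f x) has_integral b) UNIV"
  proof (rule nn_integral_has_integral)
    show "(\<lambda>x. indicator A x *\<^sub>R f x) \<in> borel_measurable borel"
      using assms(1) by (simp add: set_borel_measurable_def)
    show "(\<integral>\<^sup>+ x. ennreal (indicat_real A x *\<^sub>R f x) \<partial>lborel) = ennreal b"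
      unfolding *[symmetric] by (intro nn_integral_cong) (auto simp: indicator_def)
  qed (use assms in \<open>auto simp: indicator_def\<close>)
  also have "(\<lambda>x. indicator A x *\<^sub>R f x) = (\<lambda>x. if x \<in> A then f x else 0)"
    by (auto simp: indicator_def)
  finally have "(f has_integral b) A"
    by (simp add: has_integral_restrict_UNIV)
  then show "f absolutely_integrable_on A \<and> integral A f = b"
    using nonneg by (auto simp: absolutely_integrable_on_iff_nonneg has_integral_iff)
next
  assume "f absolutely_integrable_on A \<and> integral A f = b"
  then have "(f has_integral b) A"
    using set_lebesgue_integral_eq_integral(1) by (auto simp: has_integral_iff)
  then show "(\<integral>\<^sup>+x\<in>A. f x \<partial>lborel) = ennreal b"
    using nonneg by (rule nn_integral_has_integral_lebesgue'[rotated])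
qed

text \<open>The theorem on absolutely integrable functions shows that the two sides agree as soon as
  one of them is finite. In the remaining case both are infinite.\<close>

lemma set_nn_integral_change_of_variables:
  fixes f g g' :: "real \<Rightarrow> real"
  assumes [measurable]: "S \<in> sets borel" "g ` S \<in> sets borel"
      "f \<in> borel_measurable borel" "g \<in> borel_measurable borel" "g' \<in> borel_measurable borel"
    and der: "\<And>x. x \<in> S \<Longrightarrow> (g has_field_derivative g' x) (at x)"
    and inj: "inj_on g S" and nonneg: "\<And>x. x \<in> g ` S \<Longrightarrow> 0 \<le> f x"
  shows "(\<integral>\<^sup>+x\<in>g ` S. f x \<partial>lborel) = (\<integral>\<^sup>+x\<in>S. ennreal (\<bar>g' x\<bar> * f (g x)) \<partial>lborel)" (is "?l = ?r")
proof -
  have eq: "?l = ennreal b \<longleftrightarrow> ?r = ennreal b" if "b \<ge> 0" for b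
  proof -
    have "?l = ennreal b \<longleftrightarrow> f absolutely_integrable_on g ` S \<and> integral (g ` S) f = b"
      by (rule set_nn_integral_eq_ennreal_iff) (use nonneg that in \<open>auto simp: set_borel_measurable_def\<close>)
    also have "\<dots> \<longleftrightarrow> (\<lambda>x. \<bar>g' x\<bar> * f (g x)) absolutely_integrable_on S \<and>
        integral S (\<lambda>x. \<bar>g' x\<bar> * f (g x)) = b"
      by (rule has_absolute_integral_change_of_variables_1'[symmetric])
        (use der inj in \<open>auto intro: has_field_derivative_at_within\<close>)
    also have "\<dots> \<longleftrightarrow> ?r = ennreal b"
      by (rule set_nn_integral_eq_ennreal_iff[symmetric])
        (use nonneg that in \<open>auto simp: set_borel_measurable_def\<close>)
    finally show ?thesis .
  qed
  show ?thesis
  proof (cases "?l = \<infinity> \<and> ?r = \<infinity>")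
    case False
    then consider b where "b \<ge> 0" "?l = ennreal b" | b where "b \<ge> 0" "?r = ennreal b"
      by (metis ennreal_cases infinity_ennreal_def)
    then show ?thesis using eq by cases metis+
  qed simp
qed

text \<open>The origin is a null set and reflection carries one half-line to the other. This folding
  is what turns \<open>exp (m * t)\<close> into \<open>cosh (m * t)\<close> in the Bessel integral
  and \<open>exp (\<beta> * x)\<close> into \<open>cosh (\<beta> * x)\<close> in the
  moments.\<close>

lemma nn_integral_lborel_split_sign:
  fixes f :: "real \<Rightarrow> ennreal"
  assumes [measurable]: "f \<in> borel_measurable borel"
  shows "(\<integral>\<^sup>+x. f x \<partial>lborel) = (\<integral>\<^sup>+x\<in>{0<..}. f x + f (-x) \<partial>lborel)"
proof -
  have neg: "(\<integral>\<^sup>+x\<in>{..<0}. f x \<partial>lborel) = (\<integral>\<^sup>+x\<in>{0<..}. f (-x) \<partial>lborel)"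
    by (subst nn_integral_real_affine[where c = "-1" and t = 0])
      (auto intro!: nn_integral_cong simp: indicator_def)
  have "(\<integral>\<^sup>+x. f x \<partial>lborel) = (\<integral>\<^sup>+x. f x * indicator {0<..} x + f x * indicator {..<0} x \<partial>lborel)"
    by (rule nn_integral_cong_AE, rule AE_mp[OF AE_lborel_singleton[of 0]])
      (auto simp: indicator_def)
  also have "\<dots> = (\<integral>\<^sup>+x\<in>{0<..}. f x + f (-x) \<partial>lborel)"
    by (simp add: nn_integral_add neg distrib_right)
  finally show ?thesis .
qed

section \<open>Integral representation of the modified Bessel function\<close>

text \<open>At x = 0 this is the integrand of \<open>Gamma m\<close>. Both the Mellin transform and
  the limit at the origin end in that case.\<close>

definition bessel_kernel :: "real \<Rightarrow> real \<Rightarrow> real \<Rightarrow> real" where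
  "bessel_kernel m x v = v powr (m - 1) * exp (- v - x\<^sup>2 / (4 * v))"

lemma bessel_kernel_nonneg: "0 \<le> bessel_kernel m x v"
  by (simp add: bessel_kernel_def)

lemma measurable_bessel_kernel [measurable]:
  "(\<lambda>(x, v). bessel_kernel m x v) \<in> borel_measurable (borel \<Otimes>\<^sub>M borel)"
  unfolding bessel_kernel_def by measurable

lemma nn_integral_bessel_kernel_zero:
  assumes "m > 0"
  shows "(\<integral>\<^sup>+v\<in>{0<..}. bessel_kernel m 0 v \<partial>lborel) = ennreal (Gamma m)"
proof -
  have "ennreal (Gamma m) = (\<integral>\<^sup>+t. ennreal (indicator {0..} t * t powr (m - 1) / exp t) \<partial>lborel)"
    by (rule Gamma_conv_nn_integral_real) fact
  also have "\<dots> = (\<integral>\<^sup>+v\<in>{0<..}. bessel_kernel m 0 v \<partial>lborel)"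
    by (intro nn_integral_cong)
      (auto simp: bessel_kernel_def indicator_def exp_minus field_simps)
  finally show ?thesis ..
qed

text \<open>The order m may be negative, so the power of v may be singular at 0. The factor exp
  (-x^2/(4v)) vanishes there faster than any power v^j, and trading it for v^j leaves a Gamma
  integrand of positive order m + j.\<close>

lemma nn_integral_bessel_kernel_finite:
  assumes "x \<noteq> 0"
  shows "(\<integral>\<^sup>+v\<in>{0<..}. bessel_kernel m x v \<partial>lborel) < \<infinity>"
proof -
  obtain j :: nat where "- m < real j" using reals_Archimedean2 by blast
  then have j: "m + j > 0" by simp
  define C where "C = fact j * (4 / x\<^sup>2) ^ j"
  have "(\<integral>\<^sup>+v\<in>{0<..}. bessel_kernel m x v \<partial>lborel)
      \<le> (\<integral>\<^sup>+v. ennreal C * (ennreal (bessel_kernel (m + j) 0 v) * indicator {0<..} v) \<partial>lborel)"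
  proof (intro nn_integral_mono)
    fix v :: real
    show "ennreal (bessel_kernel m x v) * indicator {0<..} v
        \<le> ennreal C * (ennreal (bessel_kernel (m + j) 0 v) * indicator {0<..} v)"
    proof (cases "v > 0")
      case True
      define y where "y = x\<^sup>2 / (4 * v)"
      have y: "y > 0" using assms True by (simp add: y_def)
      \<comment> \<open>A single term of the exponential series gives y^j / j! as a lower bound of
        exp y.\<close>
      have "(\<Sum>i\<in>{j}. inverse (fact i) * y ^ i) \<le> (\<Sum>i. inverse (fact i) * y ^ i)"
        using y by (intro sum_le_suminf) (auto simp: summable_exp)
      then have "exp y \<ge> y ^ j / fact j"
        by (simp add: exp_def field_simps)
      then have "exp (-y) \<le> fact j / y ^ j"
        using y by (simp add: exp_minus field_simps)
      also have "\<dots> = C * v ^ j"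
        using True assms by (simp add: C_def y_def field_simps)
      finally have "v powr (m - 1) * exp (-v) * exp (-y) \<le> v powr (m - 1) * exp (-v) * (C * v ^ j)"
        by (intro mult_left_mono) auto
      also have "\<dots> = C * bessel_kernel (m + j) 0 v"
        using True by (simp add: bessel_kernel_def powr_add powr_diff powr_realpow field_simps)
      also have "v powr (m - 1) * exp (-v) * exp (-y) = bessel_kernel m x v"
        by (simp add: bessel_kernel_def y_def exp_diff exp_minus field_simps)
      finally show ?thesis
        using True by (auto simp: C_def ennreal_mult[symmetric] bessel_kernel_nonneg intro!: ennreal_leI)
    qed simp
  qed
  also have "\<dots> = ennreal C * ennreal (Gamma (m + j))"
    using nn_integral_bessel_kernel_zero[OF j] by (subst nn_integral_cmult) auto
  also have "\<dots> < \<infinity>" by (simp add: ennreal_mult_less_top)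
  finally show ?thesis .
qed

lemma bessel_K_nonneg: "0 \<le> bessel_K m x"
  unfolding bessel_K_def set_lebesgue_integral_def by (intro integral_nonneg_AE) auto

lemma bessel_K_uminus_order: "bessel_K (-m) x = bessel_K m x"
  by (simp add: bessel_K_def)

text \<open>The substitution v = (x/2) exp t turns -v - x^2/(4v) into -x cosh t and v^(m-1) dv into
  (x/2)^m exp (m t) dt; folding the line at t = 0 gives the factor 2 and the \<open>cosh\<close>.
  Extended integrals are used because the finiteness of the right-hand integral is to be deduced
  from this identity.\<close>

lemma nn_integral_bessel_K_kernel:
  assumes "x > 0"
  shows "(\<integral>\<^sup>+v\<in>{0<..}. bessel_kernel m x v \<partial>lborel) =
    ennreal (2 * (x / 2) powr m) * (\<integral>\<^sup>+t\<in>{0<..}. ennreal (exp (- x * cosh t) * cosh (m * t)) \<partial>lborel)"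
proof -
  have [measurable]: "(\<lambda>v. bessel_kernel m x v) \<in> borel_measurable borel"
    by measurable
  define h where "h t = exp (- x * cosh t) * exp (m * t)" for t
  have h: "(\<lambda>t. ennreal (h t)) \<in> borel_measurable borel"
    unfolding h_def cosh_def by measurable
  have "range (\<lambda>t. x / 2 * exp t) = {0<..}"
  proof (intro equalityI subsetI)
    fix y :: real assume "y \<in> {0<..}"
    then have "y = x / 2 * exp (ln (2 * y / x))" using assms by simp
    then show "y \<in> range (\<lambda>t. x / 2 * exp t)" by blast
  qed (use assms in auto)
  then have "(\<integral>\<^sup>+v\<in>{0<..}. bessel_kernel m x v \<partial>lborel) =
      (\<integral>\<^sup>+v\<in>(\<lambda>t. x / 2 * exp t) ` UNIV. bessel_kernel m x v \<partial>lborel)"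
    by simp
  also have "\<dots> = (\<integral>\<^sup>+t\<in>UNIV. ennreal (\<bar>x / 2 * exp t\<bar> * bessel_kernel m x (x / 2 * exp t)) \<partial>lborel)"
    by (rule set_nn_integral_change_of_variables)
      (use assms \<open>range (\<lambda>t. x / 2 * exp t) = {0<..}\<close> in
        \<open>auto intro!: derivative_eq_intros simp: inj_on_def bessel_kernel_nonneg\<close>)
  also have "\<dots> = (\<integral>\<^sup>+t. ennreal ((x / 2) powr m) * h t \<partial>lborel)"
  proof (intro nn_integral_cong)
    fix t
    have "x\<^sup>2 / (4 * (x / 2 * exp t)) = x / 2 * exp (-t)"
      using assms by (simp add: power2_eq_square exp_minus field_simps)
    then have "- (x / 2 * exp t) - x\<^sup>2 / (4 * (x / 2 * exp t)) = - x * cosh t"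
      by (simp add: cosh_def field_simps)
    moreover have "(x / 2 * exp t) * (x / 2 * exp t) powr (m - 1) = (x / 2) powr m * exp (m * t)"
    proof -
      have "(x / 2 * exp t) * (x / 2 * exp t) powr (m - 1) = (x / 2 * exp t) powr m"
        using assms by (simp add: powr_diff)
      also have "\<dots> = (x / 2) powr m * exp t powr m"
        by (rule powr_mult)
      finally show ?thesis by (simp add: powr_def)
    qed
    ultimately have "\<bar>x / 2 * exp t\<bar> * bessel_kernel m x (x / 2 * exp t) = (x / 2) powr m * h t"
      using assms by (simp add: bessel_kernel_def h_def mult.assoc[symmetric])
    then show "ennreal (\<bar>x / 2 * exp t\<bar> * bessel_kernel m x (x / 2 * exp t)) * indicator UNIV t
        = ennreal ((x / 2) powr m) * ennreal (h t)"
      by (simp add: ennreal_mult h_def)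
  qed
  also have "\<dots> = ennreal ((x / 2) powr m) * (\<integral>\<^sup>+t\<in>{0<..}. ennreal (h t) + ennreal (h (-t)) \<partial>lborel)"
    using h by (simp add: nn_integral_cmult nn_integral_lborel_split_sign[OF h])
  also have "(\<integral>\<^sup>+t\<in>{0<..}. ennreal (h t) + ennreal (h (-t)) \<partial>lborel) =
      (\<integral>\<^sup>+t. ennreal 2 * (ennreal (exp (- x * cosh t) * cosh (m * t)) * indicator {0<..} t) \<partial>lborel)"
  proof (intro nn_integral_cong)
    fix t
    have "h t + h (-t) = 2 * (exp (- x * cosh t) * cosh (m * t))"
      by (simp add: h_def cosh_def field_simps)
    then show "(ennreal (h t) + ennreal (h (-t))) * indicator {0<..} t =
        ennreal 2 * (ennreal (exp (- x * cosh t) * cosh (m * t)) * indicator {0<..} t)"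
      by (subst ennreal_plus[symmetric]) (auto simp: h_def ennreal_mult mult.assoc)
  qed
  also have "\<dots> = ennreal 2 * (\<integral>\<^sup>+t\<in>{0<..}. ennreal (exp (- x * cosh t) * cosh (m * t)) \<partial>lborel)"
    unfolding cosh_def by (rule nn_integral_cmult) measurable
  finally show ?thesis
    by (simp add: ennreal_mult mult_ac)
qed

text \<open>\<open>bessel_K\<close> is a Bochner integral, which is 0 by default when the integrand
  is not integrable. Integrability is inherited from the finite kernel integral, since the factor
  relating the two is positive.\<close>

lemma nn_integral_bessel_K:
  assumes "x > 0"
  shows "(\<integral>\<^sup>+t\<in>{0<..}. ennreal (exp (- x * cosh t) * cosh (m * t)) \<partial>lborel) = ennreal (bessel_K m x)"
proof -
  let ?I = "\<integral>\<^sup>+t\<in>{0<..}. ennreal (exp (- x * cosh t) * cosh (m * t)) \<partial>lborel"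
  have "ennreal (2 * (x / 2) powr m) * ?I < \<infinity>"
    using nn_integral_bessel_K_kernel[OF assms, of m] nn_integral_bessel_kernel_finite[of x m] assms
    by simp
  moreover have "2 * (x / 2) powr m > 0" using assms by simp
  ultimately have fin: "?I < \<infinity>"
    by (auto simp: ennreal_mult_less_top)
  have eq: "?I = (\<integral>\<^sup>+t. ennreal (indicator {0<..} t *\<^sub>R (exp (- x * cosh t) * cosh (m * t))) \<partial>lborel)"
    by (intro nn_integral_cong) (auto simp: indicator_def)
  have meas: "(\<lambda>t. indicator {0<..} t *\<^sub>R (exp (- x * cosh t) * cosh (m * t))) \<in> borel_measurable lborel"
    unfolding cosh_def by measurable
  have "integrable lborel (\<lambda>t. indicator {0<..} t *\<^sub>R (exp (- x * cosh t) * cosh (m * t)))"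
    by (rule integrableI_nonneg[OF meas]) (use fin eq in auto)
  then show ?thesis
    unfolding eq bessel_K_def set_lebesgue_integral_def by (intro nn_integral_eq_integral) auto
qed

text \<open>In this extended form the representation can be inserted directly under another integral
  of a nonnegative function.\<close>

lemma bessel_K_eq_kernel:
  assumes "x > 0"
  shows "ennreal (x powr m * bessel_K m x) =
    ennreal (2 powr (m - 1)) * (\<integral>\<^sup>+v\<in>{0<..}. bessel_kernel m x v \<partial>lborel)"
proof -
  have "2 powr (m - 1) * (2 * (x / 2) powr m) = x powr m"
    using assms by (simp add: powr_divide powr_diff field_simps)
  then show ?thesis
    using assms unfolding nn_integral_bessel_K_kernel[OF assms] nn_integral_bessel_K[OF assms]
    by (simp add: ennreal_mult[symmetric] bessel_K_nonneg mult.assoc[symmetric])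
qed

subsection \<open>Mellin transform\<close>

text \<open>The substitution y = x^2/(4v) reduces the Gaussian moment to the integral for
  \<open>Gamma (s / 2)\<close>.\<close>

lemma nn_integral_powr_gaussian:
  fixes s v :: real
  assumes "s > 0" "v > 0"
  shows "(\<integral>\<^sup>+x\<in>{0<..}. ennreal (x powr (s - 1) * exp (- (x\<^sup>2 / (4 * v)))) \<partial>lborel) =
    ennreal (2 powr (s - 1) * v powr (s / 2) * Gamma (s / 2))"
proof -
  define g where "g x = x\<^sup>2 / (4 * v)" for x :: real
  define f where "f y = y powr (s / 2 - 1) * exp (- y)" for y :: real
  have g_image: "g ` {0<..} = {0<..}"
  proof (intro equalityI subsetI)
    fix y :: real assume "y \<in> {0<..}"
    then have "y = g (2 * sqrt (v * y))" "2 * sqrt (v * y) > 0"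
      using assms by (auto simp: g_def power_mult_distrib)
    then show "y \<in> g ` {0<..}" by blast
  qed (use assms in \<open>auto simp: g_def\<close>)
  have "ennreal (Gamma (s / 2)) = (\<integral>\<^sup>+y\<in>{0<..}. bessel_kernel (s / 2) 0 y \<partial>lborel)"
    using assms by (intro nn_integral_bessel_kernel_zero[symmetric]) auto
  also have "\<dots> = (\<integral>\<^sup>+y\<in>g ` {0<..}. f y \<partial>lborel)"
    by (simp add: g_image f_def bessel_kernel_def)
  also have "\<dots> = (\<integral>\<^sup>+x\<in>{0<..}. ennreal (\<bar>x / (2 * v)\<bar> * f (g x)) \<partial>lborel)"
  proof (rule set_nn_integral_change_of_variables)
    show "inj_on g {0<..}"
      using assms by (auto simp: inj_on_def g_def)
  qed (use assms g_image in \<open>auto intro!: derivative_eq_intros simp: g_def[abs_def] f_def[abs_def]\<close>)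
  also have "\<dots> = (\<integral>\<^sup>+x. ennreal (2 * (4 * v) powr (- (s / 2))) *
      (ennreal (x powr (s - 1) * exp (- (x\<^sup>2 / (4 * v)))) * indicator {0<..} x) \<partial>lborel)"
  proof (intro nn_integral_cong)
    fix x :: real
    have "\<bar>x / (2 * v)\<bar> * f (g x) = 2 * (4 * v) powr (- (s / 2)) * (x powr (s - 1) * exp (- (x\<^sup>2 / (4 * v))))"
      if "x > 0"
    proof -
      have "(x\<^sup>2) powr (s / 2 - 1) = x powr (2 * (s / 2 - 1))"
        unfolding powr_powr[symmetric] using that by (simp add: powr_numeral)
      then have "x / (2 * v) * (x\<^sup>2 / (4 * v)) powr (s / 2 - 1) =
          x / (2 * v) * (x powr (s - 2) / (4 * v) powr (s / 2 - 1))"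
        by (simp add: powr_divide right_diff_distrib)
      also have "\<dots> = 2 * (4 * v) powr (- (s / 2)) * x powr (s - 1)"
      proof -
        have *: "(4 * v) powr (s / 2 - 1) = (4 * v) powr (s / 2) / (4 * v)"
          "x powr (s - 2) = x powr (s - 1) / x"
          using that assms powr_diff[of x "s - 1" 1] by (simp_all add: powr_diff[of _ "s / 2" 1])
        show ?thesis
          unfolding * powr_minus using that assms by (simp add: divide_simps)
      qed
      finally have "x / (2 * v) * (x\<^sup>2 / (4 * v)) powr (s / 2 - 1) * exp (- (x\<^sup>2 / (4 * v))) =
          2 * (4 * v) powr (- (s / 2)) * x powr (s - 1) * exp (- (x\<^sup>2 / (4 * v)))"
        by (rule arg_cong)
      then show ?thesis
        using that assms by (simp add: f_def g_def)
    qed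
    then show "ennreal (\<bar>x / (2 * v)\<bar> * f (g x)) * indicator {0<..} x =
        ennreal (2 * (4 * v) powr (- (s / 2))) *
        (ennreal (x powr (s - 1) * exp (- (x\<^sup>2 / (4 * v)))) * indicator {0<..} x)"
      using assms by (auto simp: indicator_def ennreal_mult)
  qed
  also have "\<dots> = ennreal (2 * (4 * v) powr (- (s / 2))) *
      (\<integral>\<^sup>+x\<in>{0<..}. ennreal (x powr (s - 1) * exp (- (x\<^sup>2 / (4 * v)))) \<partial>lborel)" (is "_ = _ * ?I")
    by (rule nn_integral_cmult) measurable
  finally have eq: "ennreal (Gamma (s / 2)) = ennreal (2 * (4 * v) powr (- (s / 2))) * ?I" .
  \<comment> \<open>The two constants are reciprocal, so multiplying \<open>eq\<close> by the first
    isolates \<open>?I\<close> without a division of extended reals.\<close>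
  have 1: "2 powr (s - 1) * v powr (s / 2) * (2 * (4 * v) powr (- (s / 2))) = 1"
  proof -
    have "(4 * v) powr (- (s / 2)) = 2 powr (- s) * v powr (- (s / 2))"
    proof -
      have "(4::real) powr (- (s / 2)) = (2 powr 2) powr (- (s / 2))" by simp
      also have "\<dots> = 2 powr (- s)" by (simp only: powr_powr) simp
      finally show ?thesis by (simp add: powr_mult)
    qed
    then show ?thesis
      using assms by (simp add: powr_diff powr_minus field_simps)
  qed
  have "ennreal (2 powr (s - 1) * v powr (s / 2)) * ennreal (Gamma (s / 2)) = 1 * ?I"
    unfolding eq mult.assoc[symmetric] by (subst ennreal_mult[symmetric]) (use 1 assms in auto)
  then show ?thesis
    using assms by (simp add: ennreal_mult[symmetric] less_imp_le[OF Gamma_real_pos])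
qed

lemma measurable_bessel_K [measurable]: "bessel_K m \<in> borel_measurable borel"
  unfolding bessel_K_def[abs_def] set_lebesgue_integral_def cosh_def by measurable

text \<open>After inserting the kernel representation and exchanging the integrals, the inner
  integral over x is a Gaussian moment proportional to v^(s/2). This raises the order of the kernel
  at 0 from m to m + s/2, and the outer integral becomes \<open>Gamma (m + s / 2)\<close>.\<close>

lemma nn_integral_mellin_bessel_K:
  assumes "s > 0" "m + s / 2 > 0"
  shows "(\<integral>\<^sup>+x\<in>{0<..}. ennreal (x powr (s - 1) * (x powr m * bessel_K m x)) \<partial>lborel) =
    ennreal (2 powr (m + s - 2) * Gamma (s / 2) * Gamma (m + s / 2))"
proof -
  have "(\<integral>\<^sup>+x\<in>{0<..}. ennreal (x powr (s - 1) * (x powr m * bessel_K m x)) \<partial>lborel) =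
      (\<integral>\<^sup>+x. \<integral>\<^sup>+v. ennreal (2 powr (m - 1)) * (ennreal (x powr (s - 1)) * indicator {0<..} x *
        (ennreal (bessel_kernel m x v) * indicator {0<..} v)) \<partial>lborel \<partial>lborel)"
  proof (intro nn_integral_cong)
    fix x :: real
    show "ennreal (x powr (s - 1) * (x powr m * bessel_K m x)) * indicator {0<..} x =
      (\<integral>\<^sup>+v. ennreal (2 powr (m - 1)) * (ennreal (x powr (s - 1)) * indicator {0<..} x *
        (ennreal (bessel_kernel m x v) * indicator {0<..} v)) \<partial>lborel)"
    proof (cases "x > 0")
      case True
      have "ennreal (x powr (s - 1) * (x powr m * bessel_K m x)) =
          ennreal (x powr (s - 1)) * ennreal (x powr m * bessel_K m x)"
        by (rule ennreal_mult) (auto simp: bessel_K_nonneg)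
      also have "\<dots> = ennreal (2 powr (m - 1)) * (ennreal (x powr (s - 1)) *
          (\<integral>\<^sup>+v\<in>{0<..}. bessel_kernel m x v \<partial>lborel))"
        using bessel_K_eq_kernel[OF True, of m] by (simp add: mult_ac)
      finally show ?thesis
        using True by (simp add: nn_integral_cmult)
    qed simp
  qed
  also have "\<dots> = (\<integral>\<^sup>+v. \<integral>\<^sup>+x. ennreal (2 powr (m - 1)) * (ennreal (x powr (s - 1)) * indicator {0<..} x *
        (ennreal (bessel_kernel m x v) * indicator {0<..} v)) \<partial>lborel \<partial>lborel)"
    by (rule lborel_pair.Fubini') measurable
  also have "\<dots> = (\<integral>\<^sup>+v. ennreal (2 powr (m + s - 2) * Gamma (s / 2)) *
      (ennreal (bessel_kernel (m + s / 2) 0 v) * indicator {0<..} v) \<partial>lborel)"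
  proof (intro nn_integral_cong)
    fix v :: real
    show "(\<integral>\<^sup>+x. ennreal (2 powr (m - 1)) * (ennreal (x powr (s - 1)) * indicator {0<..} x *
        (ennreal (bessel_kernel m x v) * indicator {0<..} v)) \<partial>lborel) =
      ennreal (2 powr (m + s - 2) * Gamma (s / 2)) *
      (ennreal (bessel_kernel (m + s / 2) 0 v) * indicator {0<..} v)"
    proof (cases "v > 0")
      case True
      have "(\<integral>\<^sup>+x. ennreal (2 powr (m - 1)) * (ennreal (x powr (s - 1)) * indicator {0<..} x *
          (ennreal (bessel_kernel m x v) * indicator {0<..} v)) \<partial>lborel) =
        (\<integral>\<^sup>+x. ennreal (2 powr (m - 1) * v powr (m - 1) * exp (-v)) *
          (ennreal (x powr (s - 1) * exp (- (x\<^sup>2 / (4 * v)))) * indicator {0<..} x) \<partial>lborel)"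
      proof (intro nn_integral_cong)
        fix x :: real
        have "bessel_kernel m x v = v powr (m - 1) * exp (-v) * exp (- (x\<^sup>2 / (4 * v)))"
          by (simp add: bessel_kernel_def exp_diff exp_minus field_simps)
        then show "ennreal (2 powr (m - 1)) * (ennreal (x powr (s - 1)) * indicator {0<..} x *
            (ennreal (bessel_kernel m x v) * indicator {0<..} v)) =
          ennreal (2 powr (m - 1) * v powr (m - 1) * exp (-v)) *
          (ennreal (x powr (s - 1) * exp (- (x\<^sup>2 / (4 * v)))) * indicator {0<..} x)"
          using True by (simp add: ennreal_mult mult_ac)
      qed
      also have "\<dots> = ennreal (2 powr (m - 1) * v powr (m - 1) * exp (-v)) *
          ennreal (2 powr (s - 1) * v powr (s / 2) * Gamma (s / 2))"
        unfolding nn_integral_powr_gaussian[OF \<open>s > 0\<close> True, symmetric]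
        by (rule nn_integral_cmult) measurable
      also have "\<dots> = ennreal (2 powr (m - 1) * v powr (m - 1) * exp (-v) *
          (2 powr (s - 1) * v powr (s / 2) * Gamma (s / 2)))"
        using assms by (intro ennreal_mult[symmetric]) (auto intro!: mult_nonneg_nonneg less_imp_le[OF Gamma_real_pos])
      also have "2 powr (m - 1) * v powr (m - 1) * exp (-v) *
          (2 powr (s - 1) * v powr (s / 2) * Gamma (s / 2)) =
          2 powr (m + s - 2) * Gamma (s / 2) * bessel_kernel (m + s / 2) 0 v"
      proof -
        have "v powr (m + s / 2 - 1) = v powr (m - 1) * v powr (s / 2)"
          by (simp add: powr_add[symmetric] algebra_simps)
        moreover have "2 powr (m + s - 2) = 2 powr (m - 1) * 2 powr (s - 1)"
          by (simp add: powr_add[symmetric] algebra_simps)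
        ultimately show ?thesis by (simp add: bessel_kernel_def)
      qed
      also have "ennreal \<dots> = ennreal (2 powr (m + s - 2) * Gamma (s / 2)) *
          ennreal (bessel_kernel (m + s / 2) 0 v)"
        using assms by (intro ennreal_mult)
          (auto intro!: mult_nonneg_nonneg less_imp_le[OF Gamma_real_pos] simp: bessel_kernel_nonneg)
      finally show ?thesis using True by simp
    qed simp
  qed
  also have "\<dots> = ennreal (2 powr (m + s - 2) * Gamma (s / 2)) * ennreal (Gamma (m + s / 2))"
    unfolding nn_integral_bessel_kernel_zero[OF assms(2), symmetric] by (rule nn_integral_cmult) measurable
  also have "\<dots> = ennreal (2 powr (m + s - 2) * Gamma (s / 2) * Gamma (m + s / 2))"
    using assms by (intro ennreal_mult[symmetric]) (auto intro!: mult_nonneg_nonneg less_imp_le[OF Gamma_real_pos])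
  finally show ?thesis .
qed

lemma nn_integral_mellin_bessel_K_scaled:
  assumes "s > 0" "m + s / 2 > 0" "\<alpha> > 0"
  shows "(\<integral>\<^sup>+x\<in>{0<..}. ennreal (x powr (s - 1) * (x powr m * bessel_K m (\<alpha> * x))) \<partial>lborel) =
    ennreal (\<alpha> powr (- (m + s)) * 2 powr (m + s - 2) * Gamma (s / 2) * Gamma (m + s / 2))"
proof -
  have "(\<integral>\<^sup>+x\<in>{0<..}. ennreal (x powr (s - 1) * (x powr m * bessel_K m x)) \<partial>lborel) =
    ennreal \<bar>\<alpha>\<bar> * (\<integral>\<^sup>+x. ennreal ((0 + \<alpha> * x) powr (s - 1) * ((0 + \<alpha> * x) powr m * bessel_K m (0 + \<alpha> * x))) *
       indicator {0<..} (0 + \<alpha> * x) \<partial>lborel)"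
    by (rule nn_integral_real_affine) (use assms in \<open>auto intro!: borel_measurable_times\<close>)
  also have "\<dots> = (\<integral>\<^sup>+x. ennreal \<bar>\<alpha>\<bar> * (ennreal ((0 + \<alpha> * x) powr (s - 1) * ((0 + \<alpha> * x) powr m * bessel_K m (0 + \<alpha> * x))) *
       indicator {0<..} (0 + \<alpha> * x)) \<partial>lborel)"
    by (rule nn_integral_cmult[symmetric]) measurable
  also have "\<dots> = (\<integral>\<^sup>+x. ennreal (\<alpha> powr (m + s)) *
      (ennreal (x powr (s - 1) * (x powr m * bessel_K m (\<alpha> * x))) * indicator {0<..} x) \<partial>lborel)"
  proof (intro nn_integral_cong)
    fix x :: real
    have "\<alpha> * \<alpha> powr (s - 1) * \<alpha> powr m = \<alpha> powr (m + s)"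
      using assms by (simp add: powr_add powr_diff)
    then have "\<bar>\<alpha>\<bar> * ((0 + \<alpha> * x) powr (s - 1) * ((0 + \<alpha> * x) powr m * bessel_K m (0 + \<alpha> * x))) =
        \<alpha> powr (m + s) * (x powr (s - 1) * (x powr m * bessel_K m (\<alpha> * x)))"
      using assms by (simp add: powr_mult mult_ac)
    then show "ennreal \<bar>\<alpha>\<bar> * (ennreal ((0 + \<alpha> * x) powr (s - 1) * ((0 + \<alpha> * x) powr m * bessel_K m (0 + \<alpha> * x))) *
       indicator {0<..} (0 + \<alpha> * x)) = ennreal (\<alpha> powr (m + s)) *
      (ennreal (x powr (s - 1) * (x powr m * bessel_K m (\<alpha> * x))) * indicator {0<..} x)"
      using assms by (auto simp: indicator_def ennreal_mult[symmetric] bessel_K_nonneg zero_less_mult_iff)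
  qed
  also have "\<dots> = ennreal (\<alpha> powr (m + s)) *
      (\<integral>\<^sup>+x\<in>{0<..}. ennreal (x powr (s - 1) * (x powr m * bessel_K m (\<alpha> * x))) \<partial>lborel)" (is "_ = _ * ?I")
    by (rule nn_integral_cmult) measurable
  finally have eq: "ennreal (2 powr (m + s - 2) * Gamma (s / 2) * Gamma (m + s / 2)) = ennreal (\<alpha> powr (m + s)) * ?I"
    unfolding nn_integral_mellin_bessel_K[OF assms(1,2)] .
  have "ennreal (\<alpha> powr (- (m + s))) * ennreal (2 powr (m + s - 2) * Gamma (s / 2) * Gamma (m + s / 2)) = 1 * ?I"
    unfolding eq mult.assoc[symmetric]
    by (subst ennreal_mult[symmetric]) (use assms in \<open>auto simp: powr_add[symmetric]\<close>)
  then show ?thesis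
    using assms by (simp add: ennreal_mult[symmetric] less_imp_le[OF Gamma_real_pos] mult.assoc)
qed

section \<open>The hypergeometric and hyperbolic cosine series\<close>

text \<open>Ratio test: the quotient \<open>r k\<close> of consecutive terms tends to x, hence
  eventually stays below the midpoint of x and 1.\<close>

lemma summable_hyp2F1:
  fixes a b c x :: real
  assumes "a > 0" "b > 0" "c > 0" "0 \<le> x" "x < 1"
  shows "summable (\<lambda>k. pochhammer a k * pochhammer b k / pochhammer c k * (x ^ k / fact k))"
proof -
  define t where "t k = pochhammer a k * pochhammer b k / pochhammer c k * (x ^ k / fact k)" for k
  have t_nonneg: "t k \<ge> 0" for k
    using assms by (auto simp: t_def intro!: mult_nonneg_nonneg divide_nonneg_nonneg pochhammer_nonneg)
  define r where "r k = (a + real k) * (b + real k) / ((c + real k) * (real k + 1)) * x" for k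
  have step: "t (Suc k) = r k * t k" for k
    using assms by (simp add: t_def r_def pochhammer_Suc field_simps)
  have "r \<longlonglongrightarrow> 1 * x"
    unfolding r_def by (intro tendsto_mult tendsto_const) real_asymp
  then have "eventually (\<lambda>k. r k < (1 + x) / 2) sequentially"
    by (rule order_tendstoD) (use assms in simp)
  then obtain N where N: "\<And>k. k \<ge> N \<Longrightarrow> r k < (1 + x) / 2"
    by (auto simp: eventually_sequentially)
  have "summable t"
  proof (rule summable_ratio_test)
    show "(1 + x) / 2 < 1" using assms by simp
    show "norm (t (Suc k)) \<le> (1 + x) / 2 * norm (t k)" if "k \<ge> N" for k
    proof -
      have "r k \<ge> 0" using assms by (simp add: r_def)
      then show ?thesis
        using mult_right_mono[OF less_imp_le[OF N[OF that]] t_nonneg[of k]] t_nonneg[of k]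
        by (simp add: step abs_mult)
    qed
  qed
  then show ?thesis by (simp add: t_def[abs_def])
qed

text \<open>The terms are nonnegative and the one of index 0 is 1. Positivity keeps the limiting
  constants away from 0, as the passage to asymptotic equivalence demands.\<close>

lemma hyp2F1_pos:
  assumes "a > 0" "b > 0" "c > 0" "0 \<le> x" "x < 1"
  shows "hyp2F1 a b c x > 0"
proof -
  have "(\<Sum>k\<in>{0}. pochhammer a k * pochhammer b k / pochhammer c k * (x ^ k / fact k)) \<le> hyp2F1 a b c x"
    unfolding hyp2F1_def using assms
    by (intro sum_le_suminf summable_hyp2F1)
      (auto intro!: mult_nonneg_nonneg divide_nonneg_nonneg pochhammer_nonneg)
  then show ?thesis by simp
qed

text \<open>The power series over all indices vanishes at the odd ones, so it can be reindexed along
  the doubling map.\<close>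

lemma cosh_sums: "(\<lambda>k. x ^ (2 * k) / fact (2 * k)) sums cosh (x :: real)"
proof -
  have "(\<lambda>k. if even (2 * k) then x ^ (2 * k) /\<^sub>R fact (2 * k) else 0) sums cosh x"
    using cosh_converges[of x]
    by (subst sums_mono_reindex[of "\<lambda>k. 2 * k" "\<lambda>n. if even n then x ^ n /\<^sub>R fact n else 0"])
      (auto simp: strict_mono_def elim!: evenE)
  then show ?thesis by (simp add: field_simps)
qed

subsection \<open>Moments of the variance-gamma distribution\<close>

definition vg_const :: "real \<Rightarrow> real \<Rightarrow> real \<Rightarrow> real" where
  "vg_const m \<alpha> \<beta> = vg_gamma \<alpha> \<beta> powr (2 * m + 1) / (sqrt pi * (2 * \<alpha>) powr m * Gamma (m + 1/2))"

lemma vg_density_eq: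
  "vg_density m \<alpha> \<beta> x = vg_const m \<alpha> \<beta> * exp (\<beta> * x) * \<bar>x\<bar> powr m * bessel_K m (\<alpha> * \<bar>x\<bar>)"
  by (simp add: vg_density_def vg_const_def)

lemma vg_gamma_pos: "\<bar>\<beta>\<bar> < \<alpha> \<Longrightarrow> 0 < vg_gamma \<alpha> \<beta>"
  by (simp add: vg_gamma_def abs_less_iff flip: abs_le_square_iff not_le)

lemma vg_const_pos: "m > - 1/2 \<Longrightarrow> \<bar>\<beta>\<bar> < \<alpha> \<Longrightarrow> 0 < vg_const m \<alpha> \<beta>"
  using vg_gamma_pos[of \<beta> \<alpha>] by (auto simp: vg_const_def intro!: divide_pos_pos mult_pos_pos)

lemma vg_density_nonneg:
  assumes "m > - 1/2" "\<bar>\<beta>\<bar> < \<alpha>"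
  shows "0 \<le> vg_density m \<alpha> \<beta> x"
  using vg_const_pos[OF assms] by (auto simp: vg_density_eq bessel_K_nonneg)

lemma measurable_vg_density [measurable]: "vg_density m \<alpha> \<beta> \<in> borel_measurable borel"
  unfolding vg_density_eq[abs_def] by measurable

lemma vg_density_uminus: "vg_density m \<alpha> \<beta> (- x) = vg_density m \<alpha> (- \<beta>) x"
  by (simp add: vg_density_def vg_gamma_def)

text \<open>The cosine hyperbolic obtained by folding is expanded, and each power of x is integrated
  by the Mellin transform with s = p + 1 + 2k. The identity
  \<open>Gamma (c + k) = pochhammer c k * Gamma c\<close> supplies the numerators of the
  hypergeometric coefficients, and (2k)! = 4^k k! (1/2)_k supplies the denominators with their
  parameter 1/2.\<close>

lemma nn_integral_powr_vg_density:
  fixes p :: real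
  assumes m: "m > - 1/2" and \<beta>: "\<bar>\<beta>\<bar> < \<alpha>" and p: "p > -1" "2 * m + p + 1 > 0"
  shows "(\<integral>\<^sup>+x. ennreal (vg_density m \<alpha> \<beta> x * \<bar>x\<bar> powr p) \<partial>lborel) =
    ennreal (vg_const m \<alpha> \<beta> * 2 powr (m + p) * \<alpha> powr (- (m + p + 1)) * Gamma ((p + 1) / 2)
      * Gamma (m + (p + 1) / 2) * hyp2F1 ((p + 1) / 2) (m + (p + 1) / 2) (1/2) (\<beta>\<^sup>2 / \<alpha>\<^sup>2))"
proof -
  define C where "C = vg_const m \<alpha> \<beta>"
  define a where "a = (p + 1) / 2"
  define b where "b = m + (p + 1) / 2"
  define h where "h k = pochhammer a k * pochhammer b k / pochhammer (1/2) k * ((\<beta>\<^sup>2 / \<alpha>\<^sup>2) ^ k / fact k)" for k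
  define D where "D = C * 2 powr (m + p) * \<alpha> powr (- (m + p + 1)) * Gamma a * Gamma b"
  have C: "C > 0" unfolding C_def by (rule vg_const_pos) fact+
  have \<alpha>: "\<alpha> > 0" using \<beta> by simp
  have "a > 0" using p by (simp add: a_def)
  moreover have "2 * b = 2 * m + p + 1" by (simp add: b_def field_simps)
  then have "b > 0" using p by linarith
  ultimately have ab: "a > 0" "b > 0" by auto
  have D: "D > 0" using C \<alpha> ab by (simp add: D_def)
  have x1: "\<beta>\<^sup>2 / \<alpha>\<^sup>2 < 1"
    using \<beta> \<alpha> by (simp add: divide_simps) (metis abs_ge_zero power2_abs power_strict_mono zero_less_numeral)
  have h_nonneg: "h k \<ge> 0" for k
    unfolding h_def using ab
    by (auto intro!: mult_nonneg_nonneg divide_nonneg_nonneg pochhammer_nonneg)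
  have h_sums: "h sums hyp2F1 a b (1/2) (\<beta>\<^sup>2 / \<alpha>\<^sup>2)"
    unfolding hyp2F1_def h_def by (intro summable_sums summable_hyp2F1 ab x1) auto
  have "(\<integral>\<^sup>+x. ennreal (vg_density m \<alpha> \<beta> x * \<bar>x\<bar> powr p) \<partial>lborel) =
    (\<integral>\<^sup>+x\<in>{0<..}. ennreal (vg_density m \<alpha> \<beta> x * \<bar>x\<bar> powr p)
      + ennreal (vg_density m \<alpha> \<beta> (-x) * \<bar>-x\<bar> powr p) \<partial>lborel)"
    by (rule nn_integral_lborel_split_sign) measurable
  \<comment> \<open>The exponent is left in the shape s - 1 with s = p + 1 + 2 * k, to match the
    scaled Mellin transform.\<close>
  also have "\<dots> = (\<integral>\<^sup>+x. (\<Sum>k. ennreal (2 * C * \<beta> ^ (2 * k) / fact (2 * k)) *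
      (ennreal (x powr (p + 1 + 2 * real k - 1) * (x powr m * bessel_K m (\<alpha> * x))) * indicator {0<..} x)) \<partial>lborel)"
  proof (intro nn_integral_cong)
    fix x :: real
    show "(ennreal (vg_density m \<alpha> \<beta> x * \<bar>x\<bar> powr p)
      + ennreal (vg_density m \<alpha> \<beta> (-x) * \<bar>-x\<bar> powr p)) * indicator {0<..} x =
      (\<Sum>k. ennreal (2 * C * \<beta> ^ (2 * k) / fact (2 * k)) *
      (ennreal (x powr (p + 1 + 2 * real k - 1) * (x powr m * bessel_K m (\<alpha> * x))) * indicator {0<..} x))"
    proof (cases "x > 0")
      case True
      define T where "T = 2 * C * x powr p * x powr m * bessel_K m (\<alpha> * x)"
      have T: "T \<ge> 0" using C by (simp add: T_def bessel_K_nonneg)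
      have "(\<lambda>k. T * ((\<beta> * x) ^ (2 * k) / fact (2 * k))) sums (T * cosh (\<beta> * x))"
        by (intro sums_mult cosh_sums)
      moreover have "T * cosh (\<beta> * x) = vg_density m \<alpha> \<beta> x * \<bar>x\<bar> powr p + vg_density m \<alpha> \<beta> (-x) * \<bar>-x\<bar> powr p"
        using True by (simp add: T_def vg_density_eq C_def cosh_def field_simps)
      moreover have "T * ((\<beta> * x) ^ (2 * k) / fact (2 * k)) = 2 * C * \<beta> ^ (2 * k) / fact (2 * k) *
          (x powr (p + 1 + 2 * real k - 1) * (x powr m * bessel_K m (\<alpha> * x)))" for k
      proof -
        have "x powr (p + 1 + 2 * real k - 1) = x powr p * x powr real (2 * k)"
          by (simp add: powr_add[symmetric])
        also have "x powr real (2 * k) = x ^ (2 * k)"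
          using True by (rule powr_realpow)
        finally show ?thesis by (simp add: T_def power_mult_distrib)
      qed
      ultimately have "(\<lambda>k. 2 * C * \<beta> ^ (2 * k) / fact (2 * k) *
          (x powr (p + 1 + 2 * real k - 1) * (x powr m * bessel_K m (\<alpha> * x)))) sums
          (vg_density m \<alpha> \<beta> x * \<bar>x\<bar> powr p + vg_density m \<alpha> \<beta> (-x) * \<bar>-x\<bar> powr p)" (is "?f sums ?s")
        by simp
      moreover have "?f k \<ge> 0" for k
        using C by (auto simp: bessel_K_nonneg intro!: mult_nonneg_nonneg divide_nonneg_nonneg)
      ultimately have "(\<Sum>k. ennreal (?f k)) = ennreal ?s"
        by (intro suminf_ennreal_eq) auto
      then show ?thesis
        using True C vg_density_nonneg[OF m \<beta>]
        by (simp add: ennreal_mult[symmetric] bessel_K_nonneg ennreal_plus[symmetric] del: ennreal_plus)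
    qed simp
  qed
  also have "\<dots> = (\<Sum>k. \<integral>\<^sup>+x. ennreal (2 * C * \<beta> ^ (2 * k) / fact (2 * k)) *
      (ennreal (x powr (p + 1 + 2 * real k - 1) * (x powr m * bessel_K m (\<alpha> * x))) * indicator {0<..} x) \<partial>lborel)"
    by (rule nn_integral_suminf) measurable
  also have "\<dots> = (\<Sum>k. ennreal (D * h k))"
  proof (intro suminf_cong)
    fix k :: nat
    have "(\<integral>\<^sup>+x. ennreal (2 * C * \<beta> ^ (2 * k) / fact (2 * k)) *
      (ennreal (x powr (p + 1 + 2 * real k - 1) * (x powr m * bessel_K m (\<alpha> * x))) * indicator {0<..} x) \<partial>lborel)
      = ennreal (2 * C * \<beta> ^ (2 * k) / fact (2 * k)) *
       (\<integral>\<^sup>+x. ennreal (x powr (p + 1 + 2 * real k - 1) * (x powr m * bessel_K m (\<alpha> * x))) * indicator {0<..} x \<partial>lborel)"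
      by (rule nn_integral_cmult) measurable
    also have "\<dots> = ennreal (2 * C * \<beta> ^ (2 * k) / fact (2 * k)) *
        ennreal (\<alpha> powr (- (m + (p + 1 + 2 * real k))) * 2 powr (m + (p + 1 + 2 * real k) - 2) *
          Gamma ((p + 1 + 2 * real k) / 2) * Gamma (m + (p + 1 + 2 * real k) / 2))"
      by (subst nn_integral_mellin_bessel_K_scaled) (use p \<alpha> in \<open>auto simp: field_simps\<close>)
    also have "\<dots> = ennreal (2 * C * \<beta> ^ (2 * k) / fact (2 * k) *
        (\<alpha> powr (- (m + (p + 1 + 2 * real k))) * 2 powr (m + (p + 1 + 2 * real k) - 2) *
          Gamma ((p + 1 + 2 * real k) / 2) * Gamma (m + (p + 1 + 2 * real k) / 2)))"
    proof (intro ennreal_mult[symmetric] mult_nonneg_nonneg less_imp_le[OF Gamma_real_pos])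
      show "0 \<le> 2 * C * \<beta> ^ (2 * k) / fact (2 * k)" using C by simp
      show "0 < (p + 1 + 2 * real k) / 2" using p by simp
      have "m + (p + 1 + 2 * real k) / 2 = b + real k" by (simp add: b_def field_simps)
      then show "0 < m + (p + 1 + 2 * real k) / 2" using ab by simp
    qed auto
    also have "2 * C * \<beta> ^ (2 * k) / fact (2 * k) *
        (\<alpha> powr (- (m + (p + 1 + 2 * real k))) * 2 powr (m + (p + 1 + 2 * real k) - 2) *
          Gamma ((p + 1 + 2 * real k) / 2) * Gamma (m + (p + 1 + 2 * real k) / 2)) = D * h k"
    proof -
      have Gammas: "Gamma ((p + 1 + 2 * real k) / 2) = pochhammer a k * Gamma a"
        "Gamma (m + (p + 1 + 2 * real k) / 2) = pochhammer b k * Gamma b"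
      proof -
        have Gamma_shift: "Gamma (c + real k) = pochhammer c k * Gamma c" if "c > 0" for c :: real
        proof -
          have "c \<notin> \<int>\<^sub>\<le>\<^sub>0" using that by (auto elim!: nonpos_Ints_cases)
          then show ?thesis using pochhammer_Gamma[of c k] Gamma_real_pos[OF that] by simp
        qed
        have "(p + 1 + 2 * real k) / 2 = a + real k" "m + (p + 1 + 2 * real k) / 2 = b + real k"
          by (simp_all add: a_def b_def field_simps)
        then show "Gamma ((p + 1 + 2 * real k) / 2) = pochhammer a k * Gamma a"
          "Gamma (m + (p + 1 + 2 * real k) / 2) = pochhammer b k * Gamma b"
          using ab by (simp_all only: Gamma_shift)
      qed
      have \<alpha>_powr: "\<alpha> powr (- (m + (p + 1 + 2 * real k))) = \<alpha> powr (- (m + p + 1)) / \<alpha> ^ (2 * k)"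
      proof -
        have "\<alpha> powr (- (m + (p + 1 + 2 * real k))) = \<alpha> powr (- (m + p + 1) - real (2 * k))"
          by (simp add: algebra_simps)
        also have "\<dots> = \<alpha> powr (- (m + p + 1)) / \<alpha> powr real (2 * k)"
          by (rule powr_diff)
        finally show ?thesis unfolding powr_realpow[OF \<alpha>] .
      qed
      \<comment> \<open>The factor 2 from the folding is absorbed here, and
        \<open>2 ^ (2 * k)\<close> cancels against the same power in
        \<open>fact_double\<close>.\<close>
      have two_powr: "2 * 2 powr (m + (p + 1 + 2 * real k) - 2) = 2 powr (m + p) * 2 ^ (2 * k)"
      proof -
        have "2 powr (m + (p + 1 + 2 * real k) - 2) = 2 powr (m + p + real (2 * k) - 1)"
          by (simp add: algebra_simps)
        also have "\<dots> = 2 powr (m + p) * 2 powr real (2 * k) / 2"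
          by (simp only: powr_add powr_diff) simp
        also have "2 powr real (2 * k) = (2::real) ^ (2 * k)"
          by (rule powr_realpow) simp
        finally show ?thesis by simp
      qed
      have rearrange: "(2 * C * B / F) * (A * P * G * H) = C * B / F * (A * (2 * P) * G * H)" for A B F P G H :: real
        by simp
      show ?thesis
        unfolding rearrange Gammas \<alpha>_powr two_powr fact_double D_def h_def power_mult
        by (simp add: power_divide mult_ac)
    qed
    finally show "(\<integral>\<^sup>+x. ennreal (2 * C * \<beta> ^ (2 * k) / fact (2 * k)) *
      (ennreal (x powr (p + 1 + 2 * real k - 1) * (x powr m * bessel_K m (\<alpha> * x))) * indicator {0<..} x) \<partial>lborel)
      = ennreal (D * h k)" .
  qed
  also have "\<dots> = ennreal (D * hyp2F1 a b (1/2) (\<beta>\<^sup>2 / \<alpha>\<^sup>2))"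
    using D h_nonneg by (intro suminf_ennreal_eq sums_mult h_sums) auto
  finally show ?thesis
    by (simp add: D_def C_def a_def b_def)
qed

subsection \<open>Bessel functions near the origin\<close>

lemma nn_integral_bessel_kernel_eq_integral:
  assumes "(\<integral>\<^sup>+v\<in>{0<..}. bessel_kernel m x v \<partial>lborel) < \<infinity>"
  shows "integrable lborel (\<lambda>v. indicator {0<..} v * bessel_kernel m x v)"
    and "(\<integral>\<^sup>+v\<in>{0<..}. bessel_kernel m x v \<partial>lborel) =
      ennreal (\<integral>v. indicator {0<..} v * bessel_kernel m x v \<partial>lborel)"
proof -
  have eq: "(\<integral>\<^sup>+v\<in>{0<..}. bessel_kernel m x v \<partial>lborel) =
      (\<integral>\<^sup>+v. ennreal (indicator {0<..} v * bessel_kernel m x v) \<partial>lborel)"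
    by (intro nn_integral_cong) (auto simp: indicator_def)
  show int: "integrable lborel (\<lambda>v. indicator {0<..} v * bessel_kernel m x v)"
    by (rule integrableI_nonneg) (use assms in \<open>auto simp: eq bessel_kernel_nonneg\<close>)
  show "(\<integral>\<^sup>+v\<in>{0<..}. bessel_kernel m x v \<partial>lborel) =
      ennreal (\<integral>v. indicator {0<..} v * bessel_kernel m x v \<partial>lborel)"
    unfolding eq by (intro nn_integral_eq_integral int) (auto simp: bessel_kernel_nonneg)
qed

text \<open>The kernel at x is dominated by the kernel at 0, which is integrable because n is
  positive. Dominated convergence then gives the limit \<open>Gamma n\<close> for the integral
  \<open>J\<close>.\<close>

lemma tendsto_powr_bessel_K:
  assumes "n > 0"
  shows "((\<lambda>x. x powr n * bessel_K n x) \<longlongrightarrow> 2 powr (n - 1) * Gamma n) (at_right 0)"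
proof -
  define J where "J x = (\<integral>v. indicator {0<..} v * bessel_kernel n x v \<partial>lborel)" for x
  have int0: "integrable lborel (\<lambda>v. indicator {0<..} v * bessel_kernel n 0 v)"
    by (rule nn_integral_bessel_kernel_eq_integral(1)) (simp add: nn_integral_bessel_kernel_zero assms)
  have "ennreal (Gamma n) = ennreal (J 0)"
    using nn_integral_bessel_kernel_eq_integral(2)[of n 0] unfolding J_def
    by (simp add: nn_integral_bessel_kernel_zero assms)
  moreover have "J 0 \<ge> 0"
    unfolding J_def by (intro integral_nonneg_AE) (auto simp: bessel_kernel_nonneg)
  ultimately have J0: "J 0 = Gamma n"
    using assms Gamma_real_pos[of n] by (simp add: less_imp_le)
  have J: "x powr n * bessel_K n x = 2 powr (n - 1) * J x" if "x > 0" for x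
  proof -
    have "ennreal (x powr n * bessel_K n x) = ennreal (2 powr (n - 1)) * ennreal (J x)"
      unfolding bessel_K_eq_kernel[OF that] J_def
      by (subst nn_integral_bessel_kernel_eq_integral(2))
        (use nn_integral_bessel_kernel_finite[of x n] that in auto)
    also have "\<dots> = ennreal (2 powr (n - 1) * J x)"
      by (rule ennreal_mult''[symmetric]) (auto simp: J_def bessel_kernel_nonneg intro!: integral_nonneg_AE)
    finally show ?thesis
      by (subst (asm) ennreal_inj)
        (auto simp: bessel_K_nonneg J_def bessel_kernel_nonneg intro!: mult_nonneg_nonneg integral_nonneg_AE)
  qed
  \<comment> \<open>Dominated convergence is applied along \<open>at_top\<close>, so the limit at 0
    from the right is transported by inversion.\<close>
  have "((\<lambda>x. J (inverse x)) \<longlongrightarrow> J 0) at_top"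
    unfolding J_def
  proof (rule integral_dominated_convergence_at_top[where w = "\<lambda>v. indicator {0<..} v * bessel_kernel n 0 v"])
    show "AE v in lborel. ((\<lambda>x. indicat_real {0<..} v * bessel_kernel n (inverse x) v) \<longlongrightarrow>
        indicat_real {0<..} v * bessel_kernel n 0 v) at_top"
    proof (rule AE_I2)
      fix v :: real
      show "((\<lambda>x. indicat_real {0<..} v * bessel_kernel n (inverse x) v) \<longlongrightarrow>
        indicat_real {0<..} v * bessel_kernel n 0 v) at_top"
      proof (cases "v > 0")
        case True
        then show ?thesis
          unfolding bessel_kernel_def by (intro tendsto_intros tendsto_inverse_0_at_top filterlim_ident) auto
      qed simp
    qed
    show "\<forall>\<^sub>F x in at_top. AE v in lborel. norm (indicat_real {0<..} v * bessel_kernel n (inverse x) v)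
        \<le> indicat_real {0<..} v * bessel_kernel n 0 v"
      by (intro always_eventually allI AE_I2)
        (auto simp: bessel_kernel_def indicator_def intro!: mult_left_mono)
  qed (use int0 in auto)
  then have "(J \<longlongrightarrow> Gamma n) (at_right 0)"
    by (simp add: filterlim_at_right_to_top J0)
  then have "((\<lambda>x. 2 powr (n - 1) * J x) \<longlongrightarrow> 2 powr (n - 1) * Gamma n) (at_right 0)"
    by (intro tendsto_intros)
  then show ?thesis
    by (rule Lim_transform_eventually)
      (auto simp: eventually_at_right_field J intro!: exI[of _ 1])
qed

text \<open>At order 0 the kernel of x = 0 is not integrable, so the defining integral is estimated
  directly. From below, exp (-x cosh t) is at least 1 - x exp t. From above, it is at most 1 and at
  most (2/x) exp (-t); the former is used up to a cut-off point and the latter beyond it.\<close>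

lemma bessel_K_0_bounds:
  assumes "0 < x" "x < 1"
  shows "ln (1 / x) - 1 \<le> bessel_K 0 x" and "bessel_K 0 x \<le> ln (2 / x) + 1"
proof -
  have K: "ennreal (bessel_K 0 x) = (\<integral>\<^sup>+t\<in>{0<..}. ennreal (exp (- x * cosh t)) \<partial>lborel)"
    using nn_integral_bessel_K[OF assms(1), of 0] by simp
  show "ln (1 / x) - 1 \<le> bessel_K 0 x"
  proof -
    \<comment> \<open>The point where the lower bound 1 - x exp t reaches 0.\<close>
    define T where "T = ln (1 / x)"
    have T: "T > 0" "exp T = 1 / x" using assms by (simp_all add: T_def)
    have int: "((\<lambda>t. 1 - x * exp t) has_integral ((T - x * exp T) - (0 - x * exp 0))) {0..T}"
      by (rule fundamental_theorem_of_calculus)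
        (use T in \<open>auto intro!: derivative_eq_intros simp flip: has_real_derivative_iff_has_vector_derivative\<close>)
    have "ennreal (T - 1) \<le> ennreal ((T - x * exp T) - (0 - x * exp 0))"
      using assms T by (intro ennreal_leI) auto
    also have "\<dots> = (\<integral>\<^sup>+t\<in>{0..T}. ennreal (1 - x * exp t) \<partial>lborel)"
    proof (rule nn_integral_has_integral_lebesgue'[symmetric, OF _ int])
      fix t assume "t \<in> {0..T}"
      then have "x * exp t \<le> x * exp T" using assms by (intro mult_left_mono) auto
      then show "0 \<le> 1 - x * exp t" using T assms by simp
    qed
    also have "\<dots> \<le> (\<integral>\<^sup>+t\<in>{0<..}. ennreal (exp (- x * cosh t)) \<partial>lborel)"
    proof (rule nn_integral_mono_AE, rule AE_mp[OF AE_lborel_singleton[of 0]], rule AE_I2, rule impI)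
      fix t :: real assume "t \<noteq> 0"
      have "1 - x * exp t \<le> exp (- x * cosh t)" if "t > 0"
      proof -
        have "cosh t \<le> exp t" using that by (simp add: cosh_def)
        then have "x * cosh t \<le> x * exp t" using assms by (intro mult_left_mono) auto
        then show ?thesis using exp_ge_add_one_self[of "- x * cosh t"] by linarith
      qed
      then show "ennreal (1 - x * exp t) * indicator {0..T} t \<le> ennreal (exp (- x * cosh t)) * indicator {0<..} t"
        using \<open>t \<noteq> 0\<close> by (auto simp: indicator_def intro!: ennreal_leI)
    qed
    finally show ?thesis
      unfolding K[symmetric] T_def using bessel_K_nonneg by (subst (asm) ennreal_le_iff) auto
  qed
  show "bessel_K 0 x \<le> ln (2 / x) + 1"
  proof -
    \<comment> \<open>The point where (2/x) exp (-t) has decreased to 1; the tail beyond it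
      contributes exactly 1.\<close>
    define T where "T = ln (2 / x)"
    have T: "T > 0" "exp T = 2 / x" using assms by (simp_all add: T_def)
    have int: "((\<lambda>t. exp (- 1 * t)) has_integral exp (- 1 * T) / 1) {T..}"
      by (rule has_integral_exp_minus_to_infinity) simp
    have "ennreal (bessel_K 0 x) \<le> (\<integral>\<^sup>+t. indicator {0..T} t +
        ennreal (2 / x) * (ennreal (exp (- 1 * t)) * indicator {T..} t) \<partial>lborel)"
      unfolding K
    proof (rule nn_integral_mono)
      fix t :: real
      have "exp (- x * cosh t) \<le> 2 / x * exp (- 1 * t)"
      proof -
        have "x * exp t / 2 \<le> x * cosh t"
          using assms by (simp add: cosh_def)
        also have "\<dots> \<le> exp (x * cosh t)"
          using exp_ge_add_one_self[of "x * cosh t"] by linarith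
        finally show ?thesis
          using assms by (simp add: exp_minus field_simps)
      qed
      moreover have "exp (- x * cosh t) \<le> 1" using assms by simp
      ultimately show "ennreal (exp (- x * cosh t)) * indicator {0<..} t \<le>
          indicator {0..T} t + ennreal (2 / x) * (ennreal (exp (- 1 * t)) * indicator {T..} t)"
        using assms by (cases "t > 0"; cases "t \<le> T"; cases "t \<ge> T")
          (auto simp: ennreal_mult[symmetric] ennreal_le_1 intro!: ennreal_leI add_increasing2)
    qed
    also have "\<dots> = ennreal T + ennreal (2 / x) * (\<integral>\<^sup>+t\<in>{T..}. ennreal (exp (- 1 * t)) \<partial>lborel)"
      using T by (subst nn_integral_add) (auto simp: nn_integral_cmult)
    also have "(\<integral>\<^sup>+t\<in>{T..}. ennreal (exp (- 1 * t)) \<partial>lborel) = ennreal (exp (- 1 * T) / 1)"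
      by (rule nn_integral_has_integral_lebesgue'[OF _ int]) simp
    also have "ennreal T + ennreal (2 / x) * ennreal (exp (- 1 * T) / 1) = ennreal (T + 1)"
      using T assms by (simp add: ennreal_mult[symmetric] exp_minus)
    finally show ?thesis
      using T by (subst (asm) ennreal_le_iff) (auto simp: T_def)
  qed
qed

lemma tendsto_bessel_K_0:
  "((\<lambda>x. bessel_K 0 x / (- ln x)) \<longlongrightarrow> 1) (at_right 0)"
proof (rule tendsto_sandwich)
  have ev: "eventually (\<lambda>x. x \<in> {0<..<1}) (at_right (0::real))"
    by (rule eventually_at_right_real) simp
  show "eventually (\<lambda>x. (ln (1 / x) - 1) / (- ln x) \<le> bessel_K 0 x / (- ln x)) (at_right 0)"
    using ev by eventually_elim (intro divide_right_mono bessel_K_0_bounds, auto)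
  show "eventually (\<lambda>x. bessel_K 0 x / (- ln x) \<le> (ln (2 / x) + 1) / (- ln x)) (at_right 0)"
    using ev by eventually_elim (intro divide_right_mono bessel_K_0_bounds, auto)
  show "((\<lambda>x::real. (ln (1 / x) - 1) / (- ln x)) \<longlongrightarrow> 1) (at_right 0)" by real_asymp
  show "((\<lambda>x::real. (ln (2 / x) + 1) / (- ln x)) \<longlongrightarrow> 1) (at_right 0)" by real_asymp
qed

section \<open>Comparison of integrals over small intervals\<close>

text \<open>An integrated form of l'Hospital's rule: near 0 the function \<open>f\<close> lies
  between (L - e/2) \<open>g\<close> and (L + e/2) \<open>g\<close>, and these bounds are
  integrated. It converts the behaviour of a density at 0 into that of its distribution
  function.\<close>

lemma tendsto_set_nn_integral_ratio:
  fixes f g G :: "real \<Rightarrow> real"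
  assumes [measurable]: "f \<in> borel_measurable borel" "g \<in> borel_measurable borel"
    and f: "\<And>t. f t \<ge> 0" and g: "\<And>t. 0 < t \<Longrightarrow> t < 1 \<Longrightarrow> g t > 0"
    and G: "\<And>u. 0 < u \<Longrightarrow> u < 1 \<Longrightarrow> G u > 0"
    and g_integral: "\<And>u. 0 < u \<Longrightarrow> u < 1 \<Longrightarrow> (\<integral>\<^sup>+t\<in>{0<..<u}. ennreal (g t) \<partial>lborel) = ennreal (G u)"
    and lim: "((\<lambda>t. f t / g t) \<longlongrightarrow> L) (at_right 0)"
  shows "((\<lambda>u. enn2real (\<integral>\<^sup>+t\<in>{0<..<u}. ennreal (f t) \<partial>lborel) / G u) \<longlongrightarrow> L) (at_right 0)"
proof (rule tendstoI)
  fix e :: real assume e: "e > 0"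
  have ev01: "eventually (\<lambda>x. x \<in> {0<..<1}) (at_right (0::real))"
    by (rule eventually_at_right_real) simp
  from tendstoD[OF lim, of "e / 2"] e
  have "eventually (\<lambda>t. dist (f t / g t) L < e / 2) (at_right 0)" by simp
  then obtain d where d: "d > 0" "\<And>t. 0 < t \<Longrightarrow> t < d \<Longrightarrow> dist (f t / g t) L < e / 2"
    by (auto simp: eventually_at_right_field)
  have "eventually (\<lambda>x. x \<in> {0<..<d}) (at_right (0::real))"
    by (rule eventually_at_right_real) (rule d)
  with ev01 show "\<forall>\<^sub>F u in at_right 0. dist (enn2real (\<integral>\<^sup>+t\<in>{0<..<u}. ennreal (f t) \<partial>lborel) / G u) L < e"
  proof eventually_elim
    case (elim u)
    then have u: "0 < u" "u < 1" "u < d" by auto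
    define F where "F = (\<integral>\<^sup>+t\<in>{0<..<u}. ennreal (f t) \<partial>lborel)"
    have bounds: "(L - e / 2) * g t \<le> f t" "f t \<le> (L + e / 2) * g t" if "0 < t" "t < u" for t
    proof -
      have "L - e / 2 < f t / g t" "f t / g t < L + e / 2" "g t > 0"
        using d(2)[of t] g[of t] that u unfolding dist_real_def by linarith+
      then show "(L - e / 2) * g t \<le> f t" "f t \<le> (L + e / 2) * g t"
        by (simp_all add: pos_less_divide_eq pos_divide_less_eq)
    qed
    have L: "L + e / 2 \<ge> 0"
      using bounds(2)[of "u / 2"] f[of "u / 2"] g[of "u / 2"] u
      by (smt (verit, best) field_sum_of_halves half_gt_zero mult_neg_pos)
    have cmult: "(\<integral>\<^sup>+t\<in>{0<..<u}. ennreal (c * g t) \<partial>lborel) = ennreal (c * G u)" if "c \<ge> 0" for c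
    proof -
      have "(\<integral>\<^sup>+t\<in>{0<..<u}. ennreal (c * g t) \<partial>lborel) =
          (\<integral>\<^sup>+t. ennreal c * (ennreal (g t) * indicator {0<..<u} t) \<partial>lborel)"
        using that by (intro nn_integral_cong) (simp add: ennreal_mult' mult_ac)
      also have "\<dots> = ennreal c * (\<integral>\<^sup>+t\<in>{0<..<u}. ennreal (g t) \<partial>lborel)"
        by (rule nn_integral_cmult) measurable
      finally show ?thesis
        using that g_integral[of u] u by (simp add: ennreal_mult')
    qed
    have le: "F \<le> ennreal ((L + e / 2) * G u)"
      unfolding F_def cmult[OF L, symmetric]
      by (intro nn_integral_mono) (auto simp: indicator_def intro!: ennreal_leI bounds)
    \<comment> \<open>The factor L - e / 2 may be negative, whereas \<open>cmult\<close> is for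
      nonnegative constants; replacing it by 0 is harmless since \<open>f\<close> is
      nonnegative.\<close>
    have ge: "ennreal (max 0 (L - e / 2) * G u) \<le> F"
      unfolding F_def cmult[OF max.cobounded1, symmetric]
      by (intro nn_integral_mono) (use bounds f in \<open>auto simp: indicator_def max_def intro!: ennreal_leI\<close>)
    \<comment> \<open>This excludes the value 0 that \<open>enn2real\<close> assigns to
      infinity.\<close>
    have "F < \<infinity>" using le by (rule le_less_trans) simp
    then obtain r where r: "r \<ge> 0" "F = ennreal r" by (cases F) auto
    have Gu: "G u > 0" using G u by simp
    have "r \<le> (L + e / 2) * G u" "max 0 (L - e / 2) * G u \<le> r"
      using le ge r L Gu by (auto simp: ennreal_le_iff)
    then have "r / G u \<le> L + e / 2" "max 0 (L - e / 2) \<le> r / G u"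
      using Gu by (simp_all only: pos_divide_le_eq pos_le_divide_eq)
    then have "dist (r / G u) L < e" using e by (auto simp: dist_real_def)
    then show ?case using r by (simp add: F_def[symmetric])
  qed
qed

subsection \<open>Tails of ratios of independent variables\<close>

text \<open>By independence the joint law is a product, so the tail is an iterated integral. As z is
  positive, x / y > z means (x / z) / y > 1, and the inner probability is Q at x / z. Writing the
  event as u / Y > 1 treats both signs of u at once.\<close>

lemma (in prob_space) indep_ratio_tail:
  fixes X Y :: "'a \<Rightarrow> real"
  assumes indep: "indep_var borel X borel Y" and z: "z > 0"
  defines "Q \<equiv> \<lambda>u. measure M {\<omega> \<in> space M. u / Y \<omega> > 1}"
  shows "Q \<in> borel_measurable borel"
    and "measure M {\<omega> \<in> space M. X \<omega> / Y \<omega> > z} = expectation (\<lambda>\<omega>. Q (X \<omega> / z))"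
proof -
  have [measurable]: "X \<in> borel_measurable M" "Y \<in> borel_measurable M"
    using indep_var_rv1[OF indep] indep_var_rv2[OF indep] by auto
  define N where "N = distr M borel Y"
  interpret N: prob_space N unfolding N_def by (rule prob_space_distr) simp
  have sets_N [measurable_cong, simp]: "sets N = sets borel" by (simp add: N_def)
  have Q: "Q u = measure N {y. u / y > 1}" for u
    unfolding Q_def N_def by (subst measure_distr) (auto intro!: arg_cong[where f = "measure M"])
  have ratio_sets [measurable]: "{(x, y). x / y > c} \<in> sets (borel \<Otimes>\<^sub>M borel)" for c :: real
  proof -
    have "{p \<in> space (borel \<Otimes>\<^sub>M borel). fst p / snd p > c} \<in> sets (borel \<Otimes>\<^sub>M borel)"
      by measurable
    then show ?thesis by (simp add: space_pair_measure split_def)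
  qed
  have "(\<lambda>u. emeasure N (Pair u -` {(u, y). u / y > 1})) \<in> borel_measurable borel"
    by (rule N.measurable_emeasure_Pair) (simp add: ratio_sets cong: sets_pair_measure_cong)
  then have "(\<lambda>u. measure N {y. u / y > 1}) \<in> borel_measurable borel"
    by (simp add: measure_def vimage_def)
  then show Q_meas [measurable]: "Q \<in> borel_measurable borel" by (simp add: Q[abs_def])
  have "emeasure M {\<omega> \<in> space M. X \<omega> / Y \<omega> > z} =
      emeasure (distr M (borel \<Otimes>\<^sub>M borel) (\<lambda>\<omega>. (X \<omega>, Y \<omega>))) {(x, y). x / y > z}"
    by (subst emeasure_distr) (auto intro!: arg_cong[where f = "emeasure M"])
  also have "\<dots> = emeasure (distr M borel X \<Otimes>\<^sub>M N) {(x, y). x / y > z}"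
    unfolding N_def using indep_var_distribution_eq[of borel X borel Y] indep by simp
  also have "\<dots> = (\<integral>\<^sup>+x. emeasure N (Pair x -` {(x, y). x / y > z}) \<partial>distr M borel X)"
    by (rule N.emeasure_pair_measure_alt) (simp add: ratio_sets cong: sets_pair_measure_cong)
  also have "\<dots> = (\<integral>\<^sup>+x. ennreal (Q (x / z)) \<partial>distr M borel X)"
  proof (intro nn_integral_cong)
    fix x
    have "Pair x -` {(x, y). x / y > z} = {y. x / z / y > 1}"
    proof -
      have "x / z / y > 1 \<longleftrightarrow> x / y / z > 1" for y by (simp add: mult.commute)
      then have "x / z / y > 1 \<longleftrightarrow> x / y > z" for y
        using z by (simp only: less_divide_eq_1_pos)
      then show ?thesis by auto
    qed
    then show "emeasure N (Pair x -` {(x, y). x / y > z}) = ennreal (Q (x / z))"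
      by (simp add: Q N.emeasure_eq_measure)
  qed
  also have "\<dots> = (\<integral>\<^sup>+\<omega>. ennreal (Q (X \<omega> / z)) \<partial>M)"
    by (subst nn_integral_distr) auto
  also have "\<dots> = ennreal (expectation (\<lambda>\<omega>. Q (X \<omega> / z)))"
    by (rule nn_integral_eq_integral)
      (auto intro!: integrable_const_bound[where B = 1] simp: Q_def)
  finally show "measure M {\<omega> \<in> space M. X \<omega> / Y \<omega> > z} = expectation (\<lambda>\<omega>. Q (X \<omega> / z))"
    by (simp add: emeasure_eq_measure Q_def integral_nonneg_AE)
qed

text \<open>Replacing \<open>Y\<close> by \<open>-Y\<close> turns \<open>u < 0\<close> into \<open>u > 0\<close> and \<open>\<beta>\<close> into \<open>-\<beta>\<close>, hence the limit is
  required for both signs of \<open>\<beta>\<close>.\<close>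

lemma (in prob_space) tendsto_vg_small_ratio:
  fixes Y :: "'a \<Rightarrow> real" and g G :: "real \<Rightarrow> real"
  assumes Y: "vg_distributed M Y n \<alpha> \<beta>" and n: "n > - 1/2" and \<beta>: "\<bar>\<beta>\<bar> < \<alpha>"
    and [measurable]: "g \<in> borel_measurable borel"
    and g: "\<And>t. 0 < t \<Longrightarrow> t < 1 \<Longrightarrow> g t > 0"
    and G: "\<And>u. 0 < u \<Longrightarrow> u < 1 \<Longrightarrow> G u > 0"
    and g_integral: "\<And>u. 0 < u \<Longrightarrow> u < 1 \<Longrightarrow> (\<integral>\<^sup>+t\<in>{0<..<u}. ennreal (g t) \<partial>lborel) = ennreal (G u)"
    and lim: "\<And>b. \<bar>b\<bar> = \<bar>\<beta>\<bar> \<Longrightarrow> ((\<lambda>t. vg_density n \<alpha> b t / g t) \<longlongrightarrow> L) (at_right 0)"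
  shows "((\<lambda>u. measure M {\<omega> \<in> space M. u / Y \<omega> > 1} / G \<bar>u\<bar>) \<longlongrightarrow> L) (at 0)"
proof -
  define W where "W b u = enn2real (\<integral>\<^sup>+t\<in>{0<..<u}. ennreal (vg_density n \<alpha> b t) \<partial>lborel)" for b u
  have W: "((\<lambda>u. W b u / G u) \<longlongrightarrow> L) (at_right 0)" if "\<bar>b\<bar> = \<bar>\<beta>\<bar>" for b
    unfolding W_def
    by (rule tendsto_set_nn_integral_ratio[where g = g]) (use that n \<beta> vg_density_nonneg in \<open>auto intro!: lim g G g_integral\<close>)
  have Y': "distributed M lborel Y (\<lambda>x. ennreal (vg_density n \<alpha> \<beta> x))"
    using Y by (simp add: vg_distributed_def)
  have prob: "measure M {\<omega> \<in> space M. Y \<omega> \<in> A} =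
      enn2real (\<integral>\<^sup>+y\<in>A. ennreal (vg_density n \<alpha> \<beta> y) \<partial>lborel)" if "A \<in> sets borel" for A
  proof -
    have "{\<omega> \<in> space M. Y \<omega> \<in> A} = Y -` A \<inter> space M" by auto
    then show ?thesis
      using distributed_emeasure[OF Y', of A] that by (simp add: measure_def)
  qed
  have right: "measure M {\<omega> \<in> space M. u / Y \<omega> > 1} = W \<beta> u" if "u > 0" for u
  proof -
    \<comment> \<open>At y = 0 the quotient is 0 by convention, so this point lies outside the
      event, in accordance with the open interval.\<close>
    have "u / y > 1 \<longleftrightarrow> y \<in> {0<..<u}" for y
      using that by (cases "y > 0"; cases "y = 0") (auto simp: field_simps)
    then show ?thesis using prob[of "{0<..<u}"] by (simp add: W_def)
  qed
  have left: "measure M {\<omega> \<in> space M. u / Y \<omega> > 1} = W (- \<beta>) (- u)" if "u < 0" for u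
  proof -
    have "u / y > 1 \<longleftrightarrow> y \<in> {u<..<0}" for y
      using that by (cases "y > 0"; cases "y = 0") (auto simp: field_simps)
    moreover have "(\<integral>\<^sup>+y\<in>{u<..<0}. ennreal (vg_density n \<alpha> \<beta> y) \<partial>lborel) =
        (\<integral>\<^sup>+y\<in>{0<..<-u}. ennreal (vg_density n \<alpha> (- \<beta>) y) \<partial>lborel)"
      by (subst nn_integral_real_affine[where c = "-1" and t = 0])
        (auto intro!: nn_integral_cong simp: indicator_def vg_density_uminus)
    ultimately show ?thesis using prob[of "{u<..<0}"] by (simp add: W_def)
  qed
  show ?thesis
  proof (rule filterlim_split_at)
    show "((\<lambda>u. measure M {\<omega> \<in> space M. u / Y \<omega> > 1} / G \<bar>u\<bar>) \<longlongrightarrow> L) (at_right 0)"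
      by (rule Lim_transform_eventually[OF W[of \<beta>]])
        (auto simp: eventually_at_right_field right intro!: exI[of _ 1])
    have "((\<lambda>u. W (- \<beta>) (- u) / G (- u)) \<longlongrightarrow> L) (at_left 0)"
      using W[of "- \<beta>"] by (simp add: filterlim_at_left_to_right)
    then show "((\<lambda>u. measure M {\<omega> \<in> space M. u / Y \<omega> > 1} / G \<bar>u\<bar>) \<longlongrightarrow> L) (at_left 0)"
      by (rule Lim_transform_eventually)
        (auto simp: eventually_at_left_field left intro!: exI[of _ "-1"])
  qed
qed

text \<open>Dominated convergence for the expectation of r z * Q (X / z). The function
  \<open>G\<close> describes Q only near 0. The function \<open>H\<close> majorizes \<open>G\<close>
  on (0, 1) and stays above a positive constant away from 0, so that a multiple of it dominates Q at
  every nonzero point; \<open>bound\<close> then provides the integrable majorant, a multiple of 1 +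
  X^2.\<close>

lemma (in prob_space) tendsto_ratio_tail:
  fixes X Y :: "'a \<Rightarrow> real" and G H r :: "real \<Rightarrow> real"
  assumes indep: "indep_var borel X borel Y"
    and lim: "((\<lambda>u. measure M {\<omega> \<in> space M. u / Y \<omega> > 1} / G \<bar>u\<bar>) \<longlongrightarrow> L) (at 0)"
    and GH: "\<And>u. 0 < u \<Longrightarrow> u < 1 \<Longrightarrow> 0 < G u \<and> G u \<le> H u"
    and H: "\<And>u. 0 \<le> H u" "\<And>d. 0 < d \<Longrightarrow> \<exists>c>0. \<forall>u\<ge>d. c \<le> H u"
    and scale: "\<And>x. x > 0 \<Longrightarrow> ((\<lambda>z. r z * G (x / z)) \<longlongrightarrow> x powr p) at_top"
    and bound: "\<And>x z. x > 0 \<Longrightarrow> z \<ge> z0 \<Longrightarrow> 0 \<le> r z \<and> r z * H (x / z) \<le> B * (1 + x\<^sup>2)"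
    and sq: "integrable M (\<lambda>\<omega>. (X \<omega>)\<^sup>2)"
  shows "((\<lambda>z. r z * measure M {\<omega> \<in> space M. X \<omega> / Y \<omega> > z}) \<longlongrightarrow>
    L * expectation (\<lambda>\<omega>. \<bar>X \<omega>\<bar> powr p)) at_top"
proof -
  have [measurable]: "X \<in> borel_measurable M" "Y \<in> borel_measurable M"
    using indep_var_rv1[OF indep] indep_var_rv2[OF indep] by auto
  define Q where "Q u = measure M {\<omega> \<in> space M. u / Y \<omega> > 1}" for u
  have [measurable]: "Q \<in> borel_measurable borel"
    unfolding Q_def by (rule indep_ratio_tail(1)[OF indep zero_less_one])
  have Q: "0 \<le> Q u" "Q u \<le> 1" "Q 0 = 0" for u by (auto simp: Q_def)
  have lim: "((\<lambda>u. Q u / G \<bar>u\<bar>) \<longlongrightarrow> L) (at 0)" using lim by (simp add: Q_def)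
  \<comment> \<open>Below \<open>min d 1\<close> the limit bounds Q by \<bar>L\<bar> + 1 times
    \<open>G\<close>, and \<open>G\<close> is at most \<open>H\<close> there. Beyond it Q is at most
    1 and \<open>H\<close> is at least c, which accounts for 1 / c.\<close>
  obtain A where A: "A > 0" "\<And>u. u \<noteq> 0 \<Longrightarrow> Q u \<le> A * H \<bar>u\<bar>"
  proof -
    have "eventually (\<lambda>u. Q u / G \<bar>u\<bar> < \<bar>L\<bar> + 1) (at 0)"
      by (rule order_tendstoD(2)[OF lim]) simp
    then obtain d where d: "d > 0" "\<And>u. u \<noteq> 0 \<Longrightarrow> \<bar>u\<bar> < d \<Longrightarrow> Q u / G \<bar>u\<bar> < \<bar>L\<bar> + 1"
      by (auto simp: eventually_at dist_real_def)
    obtain c where c: "c > 0" "\<And>u. u \<ge> min d 1 \<Longrightarrow> c \<le> H u"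
      using H(2)[of "min d 1"] d by auto
    show ?thesis
    proof (rule that[of "max (\<bar>L\<bar> + 1) (1 / c)"])
      fix u :: real assume u: "u \<noteq> 0"
      show "Q u \<le> max (\<bar>L\<bar> + 1) (1 / c) * H \<bar>u\<bar>"
      proof (cases "\<bar>u\<bar> < min d 1")
        case True
        have G: "0 < G \<bar>u\<bar>" "G \<bar>u\<bar> \<le> H \<bar>u\<bar>" using GH[of "\<bar>u\<bar>"] True u by auto
        have "Q u \<le> (\<bar>L\<bar> + 1) * G \<bar>u\<bar>"
          using d(2)[of u] True u G by (simp add: pos_divide_less_eq)
        also have "\<dots> \<le> (\<bar>L\<bar> + 1) * H \<bar>u\<bar>" using G by (intro mult_left_mono) auto
        also have "\<dots> \<le> max (\<bar>L\<bar> + 1) (1 / c) * H \<bar>u\<bar>" by (intro mult_right_mono H) auto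
        finally show ?thesis .
      next
        case False
        then have "c \<le> H \<bar>u\<bar>" by (intro c) auto
        then have "1 \<le> 1 / c * H \<bar>u\<bar>" using c by (simp add: field_simps)
        also have "\<dots> \<le> max (\<bar>L\<bar> + 1) (1 / c) * H \<bar>u\<bar>" by (intro mult_right_mono H) auto
        finally show ?thesis using Q(2)[of u] by linarith
      qed
    qed simp
  qed
  have pointwise: "((\<lambda>z. r z * Q (x / z)) \<longlongrightarrow> L * \<bar>x\<bar> powr p) at_top" for x
  \<comment> \<open>At x = 0 both sides vanish, because Q 0 = 0 and \<open>0 powr p\<close> is
    0.\<close>
  proof (cases "x = 0")
    case False
    have "filterlim (\<lambda>z. x / z) (at 0) at_top"
      unfolding filterlim_at using False
      by (auto intro!: tendsto_divide_0[OF tendsto_const] filterlim_at_top_imp_at_infinity filterlim_ident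
          eventually_mono[OF eventually_gt_at_top[of 0]])
    then have "((\<lambda>z. Q (x / z) / G \<bar>x / z\<bar>) \<longlongrightarrow> L) at_top"
      by (rule filterlim_compose[OF lim])
    then have "((\<lambda>z. Q (x / z) / G \<bar>x / z\<bar> * (r z * G (\<bar>x\<bar> / z))) \<longlongrightarrow> L * \<bar>x\<bar> powr p) at_top"
      using False by (intro tendsto_mult scale) auto
    then show ?thesis
    proof (rule Lim_transform_eventually)
      show "\<forall>\<^sub>F z in at_top. Q (x / z) / G \<bar>x / z\<bar> * (r z * G (\<bar>x\<bar> / z)) = r z * Q (x / z)"
        using eventually_gt_at_top[of "\<bar>x\<bar>"]
      proof eventually_elim
        case (elim z)
        then have z: "z > 0" by linarith
        then have "0 < \<bar>x\<bar> / z" "\<bar>x\<bar> / z < 1" using False elim by auto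
        then have "G (\<bar>x\<bar> / z) > 0" using GH by blast
        then show ?case using z by (simp add: abs_divide)
      qed
    qed
  qed (simp add: Q)
  have "((\<lambda>z. expectation (\<lambda>\<omega>. r z * Q (X \<omega> / z))) \<longlongrightarrow> expectation (\<lambda>\<omega>. L * \<bar>X \<omega>\<bar> powr p)) at_top"
  proof (rule integral_dominated_convergence_at_top[where w = "\<lambda>\<omega>. \<bar>A * B\<bar> * (1 + (X \<omega>)\<^sup>2)"])
    show "AE \<omega> in M. ((\<lambda>z. r z * Q (X \<omega> / z)) \<longlongrightarrow> L * \<bar>X \<omega>\<bar> powr p) at_top"
      by (intro AE_I2 pointwise)
    show "\<forall>\<^sub>F z in at_top. AE \<omega> in M. norm (r z * Q (X \<omega> / z)) \<le> \<bar>A * B\<bar> * (1 + (X \<omega>)\<^sup>2)"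
      using eventually_ge_at_top[of "max z0 1"]
    proof eventually_elim
      case (elim z)
      have z: "z \<ge> z0" "z > 0" using elim by auto
      have "r z * Q (x / z) \<le> \<bar>A * B\<bar> * (1 + x\<^sup>2)" for x
      proof (cases "x = 0")
        case False
        \<comment> \<open>The instance of \<open>bound\<close> at 1 serves to obtain
          \<open>0 \<le> r z\<close>.\<close>
        have "r z * Q (x / z) \<le> r z * (A * H \<bar>x / z\<bar>)"
          using bound[OF zero_less_one z(1)] A(2)[of "x / z"] False z by (intro mult_left_mono) auto
        also have "\<dots> = A * (r z * H (\<bar>x\<bar> / z))" using z by (simp add: abs_divide)
        also have "\<dots> \<le> A * (B * (1 + x\<^sup>2))"
          using bound[of "\<bar>x\<bar>" z] False z A by (intro mult_left_mono) auto
        also have "\<dots> \<le> \<bar>A * B\<bar> * (1 + x\<^sup>2)"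
          unfolding mult.assoc[symmetric] by (intro mult_right_mono) (auto simp: add_nonneg_nonneg)
        finally show ?thesis .
      qed (simp add: Q)
      then show ?case using Q bound[OF zero_less_one z(1)] by (intro AE_I2) simp
    qed
    show "integrable M (\<lambda>\<omega>. \<bar>A * B\<bar> * (1 + (X \<omega>)\<^sup>2))" using sq by auto
  qed measurable
  then have "((\<lambda>z. r z * expectation (\<lambda>\<omega>. Q (X \<omega> / z))) \<longlongrightarrow> L * expectation (\<lambda>\<omega>. \<bar>X \<omega>\<bar> powr p)) at_top"
    by simp
  then show ?thesis
  proof (rule Lim_transform_eventually)
    show "\<forall>\<^sub>F z in at_top. r z * expectation (\<lambda>\<omega>. Q (X \<omega> / z)) =
        r z * measure M {\<omega> \<in> space M. X \<omega> / Y \<omega> > z}"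
      using eventually_gt_at_top[of 0]
      by eventually_elim (simp add: indep_ratio_tail(2)[OF indep] Q_def)
  qed
qed

subsection \<open>Variance-gamma ratios\<close>

lemma vg_const_abs: "\<bar>b\<bar> = \<bar>\<beta>\<bar> \<Longrightarrow> vg_const m \<alpha> b = vg_const m \<alpha> \<beta>"
  by (metis power2_abs vg_const_def vg_gamma_def)

lemma filterlim_mult_at_right_0:
  "c > 0 \<Longrightarrow> filterlim (\<lambda>t :: real. c * t) (at_right 0) (at_right 0)"
  unfolding filterlim_at
  by (auto intro!: tendsto_eq_intros eventually_mono[OF eventually_at_right_less])

text \<open>The factor t^n cancels the singularity of K_n at 0, so the density has a finite limit
  and Q(u) will be comparable to \<bar>u\<bar>.\<close>

lemma tendsto_vg_density_pos:
  assumes "n > 0" "\<bar>b\<bar> < \<alpha>"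
  shows "(vg_density n \<alpha> b \<longlongrightarrow> vg_const n \<alpha> b * (2 powr (n - 1) * Gamma n / \<alpha> powr n)) (at_right 0)"
proof -
  have \<alpha>: "\<alpha> > 0" using assms by simp
  have "((\<lambda>t. vg_const n \<alpha> b * exp (b * t) * ((\<alpha> * t) powr n * bessel_K n (\<alpha> * t) / \<alpha> powr n)) \<longlongrightarrow>
      vg_const n \<alpha> b * exp (b * 0) * (2 powr (n - 1) * Gamma n / \<alpha> powr n)) (at_right 0)"
    using \<alpha> by (intro tendsto_intros filterlim_compose[OF tendsto_powr_bessel_K[OF assms(1)]]
        filterlim_mult_at_right_0) auto
  then have "((\<lambda>t. vg_const n \<alpha> b * exp (b * t) * ((\<alpha> * t) powr n * bessel_K n (\<alpha> * t) / \<alpha> powr n)) \<longlongrightarrow>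
      vg_const n \<alpha> b * (2 powr (n - 1) * Gamma n / \<alpha> powr n)) (at_right 0)"
    by simp
  then show ?thesis
    by (rule Lim_transform_eventually)
      (use \<alpha> in \<open>auto simp: vg_density_eq powr_mult eventually_at_right_field intro!: exI[of _ 1]\<close>)
qed

text \<open>The singularity is logarithmic, and rescaling the argument by \<alpha> changes the
  logarithm by a constant only, so ln (\<alpha> t) / ln t tends to 1.\<close>

lemma tendsto_vg_density_0:
  assumes "\<bar>b\<bar> < \<alpha>"
  shows "((\<lambda>t. vg_density 0 \<alpha> b t / (- ln t)) \<longlongrightarrow> vg_const 0 \<alpha> b) (at_right 0)"
proof -
  have \<alpha>: "\<alpha> > 0" using assms by simp
  have "((\<lambda>t. ln (\<alpha> * t) / ln t) \<longlongrightarrow> 1) (at_right 0)"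
    using \<alpha> by real_asymp
  then have "((\<lambda>t. vg_const 0 \<alpha> b * exp (b * t) * (bessel_K 0 (\<alpha> * t) / (- ln (\<alpha> * t)) * (ln (\<alpha> * t) / ln t))) \<longlongrightarrow>
      vg_const 0 \<alpha> b * exp (b * 0) * (1 * 1)) (at_right 0)"
    using \<alpha> by (intro tendsto_intros filterlim_compose[OF tendsto_bessel_K_0] filterlim_mult_at_right_0)
  then have "((\<lambda>t. vg_const 0 \<alpha> b * exp (b * t) * (bessel_K 0 (\<alpha> * t) / (- ln (\<alpha> * t)) * (ln (\<alpha> * t) / ln t))) \<longlongrightarrow>
      vg_const 0 \<alpha> b) (at_right 0)"
    by simp
  then show ?thesis
  proof (rule Lim_transform_eventually)
    \<comment> \<open>Below 1 / \<alpha> the logarithm of \<alpha> * t is nonzero and therefore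
      cancels.\<close>
    have "eventually (\<lambda>t. t \<in> {0<..<min 1 (1 / \<alpha>)}) (at_right 0)"
      using \<alpha> by (intro eventually_at_right_real) auto
    then show "\<forall>\<^sub>F t in at_right 0. vg_const 0 \<alpha> b * exp (b * t) *
        (bessel_K 0 (\<alpha> * t) / (- ln (\<alpha> * t)) * (ln (\<alpha> * t) / ln t)) = vg_density 0 \<alpha> b t / (- ln t)"
    proof eventually_elim
      case (elim t)
      then have "0 < \<alpha> * t" "\<alpha> * t < 1" "t > 0" using \<alpha> by (auto simp: field_simps)
      then have "ln (\<alpha> * t) \<noteq> 0" by simp
      then show ?case using \<open>t > 0\<close> by (simp add: vg_density_eq)
    qed
  qed
qed

text \<open>The symmetry K_n = K_(-n) reduces this to the positive order -n: since K_n(t) grows like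
  t^n, its product with the factor t^n of the density is of size t^(2n).\<close>

lemma tendsto_vg_density_neg:
  assumes "n < 0" "\<bar>b\<bar> < \<alpha>"
  shows "((\<lambda>t. vg_density n \<alpha> b t / t powr (2 * n)) \<longlongrightarrow>
    vg_const n \<alpha> b * (2 powr (- n - 1) * Gamma (- n) * \<alpha> powr n)) (at_right 0)"
proof -
  have \<alpha>: "\<alpha> > 0" using assms by simp
  have "((\<lambda>t. vg_const n \<alpha> b * exp (b * t) * ((\<alpha> * t) powr (- n) * bessel_K (- n) (\<alpha> * t) * \<alpha> powr n)) \<longlongrightarrow>
      vg_const n \<alpha> b * exp (b * 0) * (2 powr (- n - 1) * Gamma (- n) * \<alpha> powr n)) (at_right 0)"
    using \<alpha> assms by (intro tendsto_intros filterlim_compose[OF tendsto_powr_bessel_K]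
        filterlim_mult_at_right_0) auto
  then have "((\<lambda>t. vg_const n \<alpha> b * exp (b * t) * ((\<alpha> * t) powr (- n) * bessel_K (- n) (\<alpha> * t) * \<alpha> powr n)) \<longlongrightarrow>
      vg_const n \<alpha> b * (2 powr (- n - 1) * Gamma (- n) * \<alpha> powr n)) (at_right 0)"
    by simp
  then show ?thesis
  proof (rule Lim_transform_eventually)
    show "\<forall>\<^sub>F t in at_right 0. vg_const n \<alpha> b * exp (b * t) *
        ((\<alpha> * t) powr (- n) * bessel_K (- n) (\<alpha> * t) * \<alpha> powr n) = vg_density n \<alpha> b t / t powr (2 * n)"
      using eventually_at_right_less[of 0]
    proof eventually_elim
      case (elim t)
      have "t powr n / t powr (2 * n) = t powr (- n)"
        using elim by (simp add: powr_diff[symmetric])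
      moreover have "(\<alpha> * t) powr (- n) * \<alpha> powr n = t powr (- n)"
        using \<alpha> elim by (simp add: powr_mult powr_minus)
      moreover have "vg_const n \<alpha> b * exp (b * t) * ((\<alpha> * t) powr (- n) * bessel_K (- n) (\<alpha> * t) * \<alpha> powr n) =
          vg_const n \<alpha> b * exp (b * t) * ((\<alpha> * t) powr (- n) * \<alpha> powr n) * bessel_K n (\<alpha> * t)"
        by (simp add: bessel_K_uminus_order)
      moreover have "vg_density n \<alpha> b t / t powr (2 * n) =
          vg_const n \<alpha> b * exp (b * t) * (t powr n / t powr (2 * n)) * bessel_K n (\<alpha> * t)"
        using elim by (simp add: vg_density_eq)
      ultimately show ?case by (simp only:)
    qed
  qed
qed

lemma (in prob_space) vg_abs_moment:
  assumes X: "vg_distributed M X m \<alpha> \<beta>" and "m > - 1/2" "\<bar>\<beta>\<bar> < \<alpha>" "p > -1" "2 * m + p + 1 > 0"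
  shows "integrable M (\<lambda>\<omega>. \<bar>X \<omega>\<bar> powr p)"
    and "expectation (\<lambda>\<omega>. \<bar>X \<omega>\<bar> powr p) =
      vg_const m \<alpha> \<beta> * 2 powr (m + p) * \<alpha> powr (- (m + p + 1)) * Gamma ((p + 1) / 2)
      * Gamma (m + (p + 1) / 2) * hyp2F1 ((p + 1) / 2) (m + (p + 1) / 2) (1/2) (\<beta>\<^sup>2 / \<alpha>\<^sup>2)" (is "_ = ?E")
proof -
  have X': "distributed M lborel X (\<lambda>x. ennreal (vg_density m \<alpha> \<beta> x))"
    using X by (simp add: vg_distributed_def)
  then have [measurable]: "X \<in> borel_measurable M"
    using distributed_measurable by fastforce
  have "\<beta>\<^sup>2 / \<alpha>\<^sup>2 < 1"
    using assms(3) by (simp add: divide_simps) (metis abs_ge_zero power2_abs power_strict_mono zero_less_numeral)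
  moreover have "m + (p + 1) / 2 > 0"
  proof -
    have "0 < (2 * m + p + 1) / 2" using assms(5) by simp
    also have "\<dots> = m + (p + 1) / 2" by (simp add: field_simps)
    finally show ?thesis .
  qed
  \<comment> \<open>The expectation can be read off from its extended value because
    \<open>?E\<close> is nonnegative; \<open>ennreal\<close> collapses negative numbers to
    0.\<close>
  ultimately have "0 < ?E"
    using assms(2-4) vg_const_pos[of m \<beta> \<alpha>] by (intro mult_pos_pos hyp2F1_pos Gamma_real_pos) auto
  have "(\<integral>\<^sup>+\<omega>. ennreal (\<bar>X \<omega>\<bar> powr p) \<partial>M) = (\<integral>\<^sup>+x. ennreal (vg_density m \<alpha> \<beta> x) * ennreal (\<bar>x\<bar> powr p) \<partial>lborel)"
    by (rule distributed_nn_integral[OF X', symmetric]) measurable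
  also have "\<dots> = (\<integral>\<^sup>+x. ennreal (vg_density m \<alpha> \<beta> x * \<bar>x\<bar> powr p) \<partial>lborel)"
    using assms by (intro nn_integral_cong ennreal_mult[symmetric] vg_density_nonneg) auto
  also have "\<dots> = ennreal ?E"
    by (rule nn_integral_powr_vg_density) fact+
  finally have nn: "(\<integral>\<^sup>+\<omega>. ennreal (\<bar>X \<omega>\<bar> powr p) \<partial>M) = ennreal ?E" .
  then show "integrable M (\<lambda>\<omega>. \<bar>X \<omega>\<bar> powr p)"
    by (intro integrableI_nonneg) auto
  show "expectation (\<lambda>\<omega>. \<bar>X \<omega>\<bar> powr p) = ?E"
    using nn \<open>0 < ?E\<close> by (intro integral_eq_nn_integral[THEN trans]) auto
qed

section \<open>From limits to asymptotic equivalence; comparison integrals and bounds\<close>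

text \<open>Wherever r z * T z = c with c nonzero, both factors are nonzero and P z / T z equals r z
  * P z / c.\<close>

lemma asymp_equiv_of_tendsto_mult:
  fixes P T r :: "real \<Rightarrow> real"
  assumes "((\<lambda>z. r z * P z) \<longlongrightarrow> c) F" "c \<noteq> 0" "eventually (\<lambda>z. r z * T z = c) F"
  shows "P \<sim>[F] T"
proof (rule asymp_equivI')
  have "((\<lambda>z. (r z * P z) / c) \<longlongrightarrow> c / c) F"
    by (intro tendsto_intros assms)
  then have "((\<lambda>z. (r z * P z) / c) \<longlongrightarrow> 1) F" using assms by simp
  then show "((\<lambda>z. P z / T z) \<longlongrightarrow> 1) F"
    by (rule Lim_transform_eventually) (use assms in \<open>auto elim!: eventually_mono\<close>)
qed

text \<open>The antiderivative t - t ln t extends continuously to 0, where its formal value is 0 as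
  well, so the fundamental theorem applies despite the singular endpoint.\<close>

lemma nn_integral_neg_ln:
  assumes "0 < u" "u < 1"
  shows "(\<integral>\<^sup>+t\<in>{0<..<u}. ennreal (- ln t) \<partial>lborel) = ennreal (u * (1 - ln u))"
proof -
  define F where "F t = t - t * ln t" for t :: real
  have F0: "(F \<longlongrightarrow> 0) (at_right 0)"
    unfolding F_def by real_asymp
  have "((\<lambda>t. - ln t) has_integral (F u - F 0)) {0..u}"
  proof (rule fundamental_theorem_of_calculus_interior)
    show "continuous_on {0..u} F"
    proof (rule continuous_on_IccI)
      show "(F \<longlongrightarrow> F 0) (at_right 0)" using F0 by (simp add: F_def)
      show "(F \<longlongrightarrow> F u) (at_left u)"
        unfolding F_def using assms by (intro tendsto_intros) auto
      show "F \<midarrow>t\<rightarrow> F t" if "0 < t" "t < u" for t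
        unfolding F_def using that by (intro tendsto_intros) auto
    qed (use assms in auto)
    show "(F has_vector_derivative - ln t) (at t)" if "t \<in> {0<..<u}" for t
      unfolding F_def using that
      by (auto intro!: derivative_eq_intros simp flip: has_real_derivative_iff_has_vector_derivative)
  qed (use assms in auto)
  then have "((\<lambda>t. - ln t) has_integral (F u - F 0)) {0<..<u}"
    by (simp add: has_integral_Icc_iff_Ioo)
  then have "(\<integral>\<^sup>+t\<in>{0<..<u}. ennreal (- ln t) \<partial>lborel) = ennreal (F u - F 0)"
    by (rule nn_integral_has_integral_lebesgue'[rotated]) (use assms in auto)
  then show ?thesis by (simp add: F_def algebra_simps)
qed

lemma nn_integral_powr_from_0:
  assumes "a > -1" "0 < u"
  shows "(\<integral>\<^sup>+t\<in>{0<..<u}. ennreal (t powr a) \<partial>lborel) = ennreal (u powr (a + 1) / (a + 1))"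
proof (rule nn_integral_has_integral_lebesgue')
  show "((\<lambda>t. t powr a) has_integral u powr (a + 1) / (a + 1)) {0<..<u}"
    using has_integral_powr_from_0[of a u] assms by (simp add: has_integral_Icc_iff_Ioo)
qed simp

text \<open>The estimate ln y \<le> y - 1 is used at x for large x and at 1 / x for small x. It
  yields the quadratic majorant in the logarithmic case n = 0.\<close>

lemma abs_ln_mult_le:
  assumes "x > (0::real)"
  shows "x * \<bar>ln x\<bar> \<le> 1 + x\<^sup>2"
proof (cases "x \<ge> 1")
  case True
  have "ln x \<le> x - 1" using assms by (rule ln_le_minus_one)
  then have "x * \<bar>ln x\<bar> \<le> x * x" using True by (intro mult_left_mono) auto
  then show ?thesis by (simp add: power2_eq_square)
next
  case False
  have "ln (1 / x) \<le> 1 / x - 1" using assms by (intro ln_le_minus_one) auto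
  then have "\<bar>ln x\<bar> \<le> 1 / x" using assms False by (simp add: ln_div)
  then have "x * \<bar>ln x\<bar> \<le> x * (1 / x)" using assms by (intro mult_left_mono) auto
  also have "\<dots> \<le> 1 + x\<^sup>2" using assms by simp
  finally show ?thesis .
qed

section \<open>The three regimes of the tail\<close>

text \<open>\<open>E p\<close> is the closed form of the absolute moment of X of order p. In the
  three cases the density of Y at 0 is compared with 1, -ln t and t^(2n), and \<open>G\<close> is
  the integral of the comparison function from 0 to u; its power of u determines which moment of X
  appears.\<close>

lemma vg_ratio_tail:
  fixes M :: "'a measure" and X Y :: "'a \<Rightarrow> real" and m n \<alpha>1 \<beta>1 \<alpha>2 \<beta>2 :: real
  assumes "prob_space M" and m: "m > - 1/2" and n: "n > - 1/2"
    and \<beta>1: "\<bar>\<beta>1\<bar> < \<alpha>1" and \<beta>2: "\<bar>\<beta>2\<bar> < \<alpha>2"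
    and X: "vg_distributed M X m \<alpha>1 \<beta>1" and Y: "vg_distributed M Y n \<alpha>2 \<beta>2"
    and indep: "prob_space.indep_var M borel X borel Y"
  defines "P \<equiv> \<lambda>z. measure M {\<omega> \<in> space M. X \<omega> / Y \<omega> > z}"
    and "E \<equiv> \<lambda>p. vg_const m \<alpha>1 \<beta>1 * 2 powr (m + p) * \<alpha>1 powr (- (m + p + 1)) * Gamma ((p + 1) / 2)
      * Gamma (m + (p + 1) / 2) * hyp2F1 ((p + 1) / 2) (m + (p + 1) / 2) (1/2) (\<beta>1\<^sup>2 / \<alpha>1\<^sup>2)"
  shows "n > 0 \<Longrightarrow> ((\<lambda>z. z * P z) \<longlongrightarrow>
      vg_const n \<alpha>2 \<beta>2 * (2 powr (n - 1) * Gamma n / \<alpha>2 powr n) * E 1) at_top"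
    and "n = 0 \<Longrightarrow> ((\<lambda>z. z / ln z * P z) \<longlongrightarrow> vg_const n \<alpha>2 \<beta>2 * E 1) at_top"
    and "n < 0 \<Longrightarrow> ((\<lambda>z. (2 * n + 1) * z powr (2 * n + 1) * P z) \<longlongrightarrow>
      vg_const n \<alpha>2 \<beta>2 * (2 powr (- n - 1) * Gamma (- n) * \<alpha>2 powr n) * E (2 * n + 1)) at_top"
proof -
  interpret prob_space M by fact
  have E: "expectation (\<lambda>\<omega>. \<bar>X \<omega>\<bar> powr p) = E p" if "p > 0" for p
    unfolding E_def by (rule vg_abs_moment(2)) (use X m \<beta>1 that in auto)
  have "integrable M (\<lambda>\<omega>. \<bar>X \<omega>\<bar> powr 2)"
    by (rule vg_abs_moment(1)) (use X m \<beta>1 in auto)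
  then have sq: "integrable M (\<lambda>\<omega>. (X \<omega>)\<^sup>2)" by simp
  show "((\<lambda>z. z * P z) \<longlongrightarrow> vg_const n \<alpha>2 \<beta>2 * (2 powr (n - 1) * Gamma n / \<alpha>2 powr n) * E 1) at_top"
    if "n > 0"
    unfolding P_def E[OF zero_less_one, symmetric]
  proof (rule tendsto_ratio_tail[where G = "\<lambda>u. u" and H = "\<lambda>u. \<bar>u\<bar>" and ?z0.0 = 1 and B = 1])
    show "((\<lambda>u. measure M {\<omega> \<in> space M. 1 < u / Y \<omega>} / \<bar>u\<bar>) \<longlongrightarrow>
        vg_const n \<alpha>2 \<beta>2 * (2 powr (n - 1) * Gamma n / \<alpha>2 powr n)) (at 0)"
    proof (rule tendsto_vg_small_ratio[OF Y n \<beta>2, where g = "\<lambda>_. 1" and G = "\<lambda>u. u"])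
      show "((\<lambda>t. vg_density n \<alpha>2 b t / 1) \<longlongrightarrow>
          vg_const n \<alpha>2 \<beta>2 * (2 powr (n - 1) * Gamma n / \<alpha>2 powr n)) (at_right 0)"
        if "\<bar>b\<bar> = \<bar>\<beta>2\<bar>" for b
        using tendsto_vg_density_pos[OF \<open>n > 0\<close>, of b \<alpha>2] that \<beta>2 by (simp add: vg_const_abs[OF that])
    qed auto
    show "((\<lambda>z. z * (x / z)) \<longlongrightarrow> x powr 1) at_top" if "x > 0" for x :: real
      by (rule tendsto_eventually) (use that in \<open>auto intro!: eventually_mono[OF eventually_gt_at_top[of 0]]\<close>)
    show "0 \<le> z \<and> z * \<bar>x / z\<bar> \<le> 1 * (1 + x\<^sup>2)" if "x > 0" "z \<ge> 1" for x z :: real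
      using that sum_squares_bound[of x 1] by (simp add: abs_divide)
  qed (use indep sq in auto)
  show "((\<lambda>z. z / ln z * P z) \<longlongrightarrow> vg_const n \<alpha>2 \<beta>2 * E 1) at_top" if "n = 0"
    unfolding P_def E[OF zero_less_one, symmetric]
  \<comment> \<open>Starting at \<open>exp 1\<close> ensures ln z \<ge> 1. The constant 2 comes from
    x (2 + \<bar>ln x\<bar>), where 2x and x \<bar>ln x\<bar> are each at most 1 + x^2.\<close>
  proof (rule tendsto_ratio_tail[where G = "\<lambda>u. u * (1 - ln u)" and H = "\<lambda>u. \<bar>u\<bar> * (1 + \<bar>ln \<bar>u\<bar>\<bar>)"
        and ?z0.0 = "exp 1" and B = 2])
    show "((\<lambda>u. measure M {\<omega> \<in> space M. 1 < u / Y \<omega>} / (\<bar>u\<bar> * (1 - ln \<bar>u\<bar>))) \<longlongrightarrow> vg_const n \<alpha>2 \<beta>2) (at 0)"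
    proof (rule tendsto_vg_small_ratio[OF Y n \<beta>2, where g = "\<lambda>t. - ln t" and G = "\<lambda>u. u * (1 - ln u)"])
      show "((\<lambda>t. vg_density n \<alpha>2 b t / - ln t) \<longlongrightarrow> vg_const n \<alpha>2 \<beta>2) (at_right 0)"
        if "\<bar>b\<bar> = \<bar>\<beta>2\<bar>" for b
        using tendsto_vg_density_0[of b \<alpha>2] that \<beta>2 \<open>n = 0\<close> by (simp add: vg_const_abs[OF that])
      show "0 < u * (1 - ln u)" if "0 < u" "u < 1" for u :: real
        using that ln_less_zero[of u] by (intro mult_pos_pos) linarith+
    qed (auto simp: nn_integral_neg_ln)
    show "0 < u * (1 - ln u) \<and> u * (1 - ln u) \<le> \<bar>u\<bar> * (1 + \<bar>ln \<bar>u\<bar>\<bar>)" if "0 < u" "u < 1" for u :: real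
    proof -
      have "ln u < 0" using that by simp
      then have "1 - ln u > 0" by linarith
      moreover have "1 - ln u \<le> 1 + \<bar>ln \<bar>u\<bar>\<bar>" using that by simp
      ultimately show ?thesis using that by (intro conjI mult_pos_pos mult_mono) linarith+
    qed
    show "\<exists>c>0. \<forall>u\<ge>d. c \<le> \<bar>u\<bar> * (1 + \<bar>ln \<bar>u\<bar>\<bar>)" if "0 < d" for d :: real
    proof (intro exI[of _ d] conjI allI impI)
      fix u assume "u \<ge> d"
      then show "d \<le> \<bar>u\<bar> * (1 + \<bar>ln \<bar>u\<bar>\<bar>)"
        using that mult_left_mono[of 1 "1 + \<bar>ln \<bar>u\<bar>\<bar>" "\<bar>u\<bar>"] by linarith
    qed fact
    show "((\<lambda>z. z / ln z * (x / z * (1 - ln (x / z)))) \<longlongrightarrow> x powr 1) at_top" if "x > 0" for x :: real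
      using that by real_asymp
    show "0 \<le> z / ln z \<and> z / ln z * (\<bar>x / z\<bar> * (1 + \<bar>ln \<bar>x / z\<bar>\<bar>)) \<le> 2 * (1 + x\<^sup>2)"
      if "x > 0" "z \<ge> exp 1" for x z :: real
    proof -
      have z: "z > 0" using that exp_gt_zero[of 1] by linarith
      have ln: "ln z \<ge> 1" using that z by (simp add: ln_ge_iff)
      have "1 + \<bar>ln (x / z)\<bar> \<le> ln z * (2 + \<bar>ln x\<bar>)"
      proof -
        have "1 + \<bar>ln (x / z)\<bar> \<le> 1 + \<bar>ln x\<bar> + ln z"
          using that z ln by (simp add: ln_div)
        also have "\<dots> \<le> ln z * (2 + \<bar>ln x\<bar>)"
          using ln mult_right_mono[OF ln, of "\<bar>ln x\<bar>"] by (simp add: algebra_simps)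
        finally show ?thesis .
      qed
      then have "(1 + \<bar>ln (x / z)\<bar>) / ln z \<le> 2 + \<bar>ln x\<bar>"
        using ln by (simp add: field_simps)
      then have "x * ((1 + \<bar>ln (x / z)\<bar>) / ln z) \<le> x * (2 + \<bar>ln x\<bar>)"
        using that by (intro mult_left_mono) auto
      also have "\<dots> \<le> 2 * (1 + x\<^sup>2)"
        using abs_ln_mult_le[OF that(1)] sum_squares_bound[of x 1] by (simp add: algebra_simps)
      finally have "x * ((1 + \<bar>ln (x / z)\<bar>) / ln z) \<le> 2 * (1 + x\<^sup>2)" .
      moreover have "0 \<le> z / ln z" using z ln by (intro divide_nonneg_nonneg) linarith+
      ultimately show ?thesis using that z by (simp add: abs_divide)
    qed
  qed (use indep sq in auto)
  show "((\<lambda>z. (2 * n + 1) * z powr (2 * n + 1) * P z) \<longlongrightarrow>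
      vg_const n \<alpha>2 \<beta>2 * (2 powr (- n - 1) * Gamma (- n) * \<alpha>2 powr n) * E (2 * n + 1)) at_top"
    if "n < 0"
  proof -
    define p where "p = 2 * n + 1"
    have p: "0 < p" "p < 1" using that n by (auto simp: p_def)
    show ?thesis
      unfolding P_def p_def[symmetric] E[OF p(1), symmetric]
    \<comment> \<open>The factor p in the rescaling cancels the divisor p of \<open>G\<close>; it is
      the origin of 1 + 2 * n in the final denominator.\<close>
    proof (rule tendsto_ratio_tail[where G = "\<lambda>u. u powr p / p" and H = "\<lambda>u. \<bar>u\<bar> powr p / p"
          and ?z0.0 = 1 and B = 1])
      show "((\<lambda>u. measure M {\<omega> \<in> space M. 1 < u / Y \<omega>} / (\<bar>u\<bar> powr p / p)) \<longlongrightarrow>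
          vg_const n \<alpha>2 \<beta>2 * (2 powr (- n - 1) * Gamma (- n) * \<alpha>2 powr n)) (at 0)"
      proof (rule tendsto_vg_small_ratio[OF Y n \<beta>2, where g = "\<lambda>t. t powr (2 * n)" and G = "\<lambda>u. u powr p / p"])
        show "((\<lambda>t. vg_density n \<alpha>2 b t / t powr (2 * n)) \<longlongrightarrow>
            vg_const n \<alpha>2 \<beta>2 * (2 powr (- n - 1) * Gamma (- n) * \<alpha>2 powr n)) (at_right 0)"
          if "\<bar>b\<bar> = \<bar>\<beta>2\<bar>" for b
          using tendsto_vg_density_neg[OF \<open>n < 0\<close>, of b \<alpha>2] that \<beta>2 by (simp add: vg_const_abs[OF that])
      qed (use p n in \<open>auto simp: nn_integral_powr_from_0 p_def\<close>)
      show "\<exists>c>0. \<forall>u\<ge>d. c \<le> \<bar>u\<bar> powr p / p" if "0 < d" for d :: real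
        using that p by (intro exI[of _ "d powr p / p"]) (auto intro!: divide_right_mono powr_mono2)
      show "((\<lambda>z. p * z powr p * ((x / z) powr p / p)) \<longlongrightarrow> x powr p) at_top" if "x > 0" for x :: real
        by (rule tendsto_eventually)
          (use that p in \<open>auto simp: powr_divide intro!: eventually_mono[OF eventually_gt_at_top[of 0]]\<close>)
      show "0 \<le> p * z powr p \<and> p * z powr p * (\<bar>x / z\<bar> powr p / p) \<le> 1 * (1 + x\<^sup>2)"
        if "x > 0" "z \<ge> 1" for x z :: real
      proof -
        have "x powr p \<le> 1 + x\<^sup>2"
        proof (cases "x \<ge> 1")
          case True
          then have "x powr p \<le> x powr 2" using p by (intro powr_mono) auto
          then show ?thesis using that by (simp add: powr_numeral)
        next
          case False
          then have "x powr p \<le> 1 powr p" using that p by (intro powr_mono2) auto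
          then show ?thesis by (simp add: add_increasing2)
        qed
        then show ?thesis using that p by (simp add: abs_divide powr_divide)
      qed
    qed (use indep sq p in auto)
  qed
qed

text \<open>What remains is to identify constants. In each case c is the claimed tail stripped of
  its dependence on z, and it is shown to be nonzero and equal to the limit given by
  \<open>vg_ratio_tail\<close>.\<close>

theorem corollary2p9:
  fixes M :: "'a measure" and X Y :: "'a \<Rightarrow> real"
    and m n \<alpha>1 \<beta>1 \<alpha>2 \<beta>2 :: real
  assumes "prob_space M"
    and "m > -1/2" and "n > -1/2"
    and "0 \<le> \<bar>\<beta>1\<bar>" and "\<bar>\<beta>1\<bar> < \<alpha>1"
    and "0 \<le> \<bar>\<beta>2\<bar>" and "\<bar>\<beta>2\<bar> < \<alpha>2"
    and "vg_distributed M X m \<alpha>1 \<beta>1"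
    and "vg_distributed M Y n \<alpha>2 \<beta>2"
    and "prob_space.indep_var M borel X borel Y"
  shows
    "(n > 0 \<longrightarrow>
       (\<lambda>z. measure M {\<omega> \<in> space M. X \<omega> / Y \<omega> > z}) \<sim>[at_top]
       (\<lambda>z. vg_gamma \<alpha>1 \<beta>1 powr (2 * m + 1) * vg_gamma \<alpha>2 \<beta>2 powr (2 * n + 1)
              / (pi * \<alpha>1 powr (2 * m + 2) * \<alpha>2 powr (2 * n))
            * (Gamma (m + 1) * Gamma n * z powr (-1) / (Gamma (m + 1/2) * Gamma (n + 1/2)))
            * hyp2F1 1 (m + 1) (1/2) (\<beta>1\<^sup>2 / \<alpha>1\<^sup>2))) \<and>
     (n = 0 \<longrightarrow>
       (\<lambda>z. measure M {\<omega> \<in> space M. X \<omega> / Y \<omega> > z}) \<sim>[at_top]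
       (\<lambda>z. 2 * vg_gamma \<alpha>1 \<beta>1 powr (2 * m + 1) * vg_gamma \<alpha>2 \<beta>2
              / (pi powr (3/2) * \<alpha>1 powr (2 * m + 2))
            * (Gamma (m + 1) * z powr (-1) * ln z / Gamma (m + 1/2))
            * hyp2F1 1 (m + 1) (1/2) (\<beta>1\<^sup>2 / \<alpha>1\<^sup>2))) \<and>
     (-1/2 < n \<and> n < 0 \<longrightarrow>
       (\<lambda>z. measure M {\<omega> \<in> space M. X \<omega> / Y \<omega> > z}) \<sim>[at_top]
       (\<lambda>z. vg_gamma \<alpha>1 \<beta>1 powr (2 * m + 1) * vg_gamma \<alpha>2 \<beta>2 powr (2 * n + 1)
              / (\<alpha>1 powr (2 * m + 2 * n + 2) * sin (- n * pi))
            * (Gamma (m + n + 1) * z powr (-1 - 2 * n)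
                 / ((1 + 2 * n) * Gamma (m + 1/2) * Gamma (n + 1/2)))
            * hyp2F1 (n + 1) (m + n + 1) (1/2) (\<beta>1\<^sup>2 / \<alpha>1\<^sup>2)))"
proof -
  note tails = vg_ratio_tail[OF assms(1-3,5,7-10)]
  have \<alpha>: "\<alpha>1 > 0" "\<alpha>2 > 0" using assms by auto
  have x1: "\<beta>1\<^sup>2 / \<alpha>1\<^sup>2 < 1"
    using assms \<alpha> by (simp add: divide_simps) (metis abs_ge_zero power2_abs power_strict_mono zero_less_numeral)
  have \<gamma>: "vg_gamma \<alpha>1 \<beta>1 > 0" "vg_gamma \<alpha>2 \<beta>2 > 0"
    using assms by (auto intro: vg_gamma_pos)
  have \<Gamma>: "Gamma (m + 1/2) > 0" "Gamma (n + 1/2) > 0" "Gamma (m + 1) > 0"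
    using assms by (auto intro!: Gamma_real_pos)
  have \<alpha>_powr: "\<alpha> powr m * \<alpha> powr (m + 2) = \<alpha> powr (2 * m + 2)" for \<alpha> :: real
    by (simp add: powr_add[symmetric] algebra_simps)
  show ?thesis
  proof (intro conjI impI)
    assume n: "n > 0"
    define F where "F = hyp2F1 1 (m + 1) (1/2) (\<beta>1\<^sup>2 / \<alpha>1\<^sup>2)"
    have F: "F > 0" unfolding F_def using assms x1 by (intro hyp2F1_pos) auto
    define c where "c = vg_gamma \<alpha>1 \<beta>1 powr (2 * m + 1) * vg_gamma \<alpha>2 \<beta>2 powr (2 * n + 1)
              / (pi * \<alpha>1 powr (2 * m + 2) * \<alpha>2 powr (2 * n))
            * (Gamma (m + 1) * Gamma n / (Gamma (m + 1/2) * Gamma (n + 1/2))) * F"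
    have "vg_const n \<alpha>2 \<beta>2 * (2 powr (n - 1) * Gamma n / \<alpha>2 powr n) *
        (vg_const m \<alpha>1 \<beta>1 * 2 powr (m + 1) * \<alpha>1 powr (- (m + 1 + 1)) * Gamma ((1 + 1) / 2)
      * Gamma (m + (1 + 1) / 2) * hyp2F1 ((1 + 1) / 2) (m + (1 + 1) / 2) (1/2) (\<beta>1\<^sup>2 / \<alpha>1\<^sup>2)) = c"
    proof -
      have eqs: "\<alpha>1 powr (2 * m + 2) = \<alpha>1 powr m * \<alpha>1 powr (m + 2)" "\<alpha>2 powr (2 * n) = \<alpha>2 powr n * \<alpha>2 powr n"
        "\<alpha>1 powr (- (m + 1 + 1)) = 1 / \<alpha>1 powr (m + 2)" "(2::real) powr (n - 1) = 2 powr n / 2"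
        by (simp_all add: powr_add[symmetric] powr_minus field_simps powr_diff)
      have two: "(2::real) powr (m + 1) = 2 * 2 powr m"
        by (simp add: powr_add)
      \<comment> \<open>Writing pi as the square of s removes the square root and leaves an identity
        between fractions.\<close>
      obtain s where s: "sqrt pi = s" "pi = s * s" "s > 0"
        by (metis abs_of_nonneg pi_gt_zero pi_ge_zero real_sqrt_gt_zero real_sqrt_mult_self)
      show ?thesis
        unfolding c_def F_def vg_const_def s(1) unfolding s(2) eqs two powr_mult
        using \<Gamma> \<alpha> s(3) by (simp add: field_simps)
    qed
    note lim = tails(1)[OF n, unfolded this]
    show "(\<lambda>z. measure M {\<omega> \<in> space M. X \<omega> / Y \<omega> > z}) \<sim>[at_top]
       (\<lambda>z. vg_gamma \<alpha>1 \<beta>1 powr (2 * m + 1) * vg_gamma \<alpha>2 \<beta>2 powr (2 * n + 1)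
              / (pi * \<alpha>1 powr (2 * m + 2) * \<alpha>2 powr (2 * n))
            * (Gamma (m + 1) * Gamma n * z powr (-1) / (Gamma (m + 1/2) * Gamma (n + 1/2)))
            * hyp2F1 1 (m + 1) (1/2) (\<beta>1\<^sup>2 / \<alpha>1\<^sup>2))"
    proof (rule asymp_equiv_of_tendsto_mult[OF lim])
      have "c > 0"
        unfolding c_def using \<gamma> \<Gamma> \<alpha> n F by (intro mult_pos_pos divide_pos_pos) auto
      then show "c \<noteq> 0" by simp
    qed (auto simp: c_def F_def powr_minus intro!: eventually_mono[OF eventually_gt_at_top[of 0]])
  next
    assume n: "n = 0"
    define F where "F = hyp2F1 1 (m + 1) (1/2) (\<beta>1\<^sup>2 / \<alpha>1\<^sup>2)"
    have F: "F > 0" unfolding F_def using assms x1 by (intro hyp2F1_pos) auto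
    define c where "c = 2 * vg_gamma \<alpha>1 \<beta>1 powr (2 * m + 1) * vg_gamma \<alpha>2 \<beta>2
              / (pi powr (3/2) * \<alpha>1 powr (2 * m + 2)) * (Gamma (m + 1) / Gamma (m + 1/2)) * F"
    have "vg_const n \<alpha>2 \<beta>2 *
        (vg_const m \<alpha>1 \<beta>1 * 2 powr (m + 1) * \<alpha>1 powr (- (m + 1 + 1)) * Gamma ((1 + 1) / 2)
      * Gamma (m + (1 + 1) / 2) * hyp2F1 ((1 + 1) / 2) (m + (1 + 1) / 2) (1/2) (\<beta>1\<^sup>2 / \<alpha>1\<^sup>2)) = c"
    proof -
      \<comment> \<open>The exponent 3/2 collects three factors \<open>sqrt pi\<close>: one from
        each density constant and one from \<open>Gamma (1/2)\<close>, the value of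
        \<open>Gamma (n + 1/2)\<close> at n = 0.\<close>
      have "pi powr (3/2) = pi powr (1 + 1/2)" by simp
      also have "\<dots> = pi * sqrt pi" by (simp only: powr_add) (simp add: powr_half_sqrt)
      finally have "pi powr (3/2) = pi * sqrt pi" .
      moreover have "\<alpha>1 powr (2 * m + 2) = \<alpha>1 powr m * \<alpha>1 powr (m + 2)"
        "\<alpha>1 powr (- (m + 1 + 1)) = 1 / \<alpha>1 powr (m + 2)"
        "sqrt pi * sqrt pi = pi"
        using \<alpha> by (simp_all add: powr_add[symmetric] powr_minus_divide[of _ "m + 2", symmetric] algebra_simps)
      moreover have "(2::real) powr (m + 1) = 2 * 2 powr m"
        by (simp add: powr_add)
      ultimately show ?thesis
        using \<Gamma> \<alpha> \<gamma> n by (simp add: c_def F_def vg_const_def powr_mult Gamma_one_half_real field_simps)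
    qed
    note lim = tails(2)[OF n, unfolded this]
    show "(\<lambda>z. measure M {\<omega> \<in> space M. X \<omega> / Y \<omega> > z}) \<sim>[at_top]
       (\<lambda>z. 2 * vg_gamma \<alpha>1 \<beta>1 powr (2 * m + 1) * vg_gamma \<alpha>2 \<beta>2
              / (pi powr (3/2) * \<alpha>1 powr (2 * m + 2))
            * (Gamma (m + 1) * z powr (-1) * ln z / Gamma (m + 1/2))
            * hyp2F1 1 (m + 1) (1/2) (\<beta>1\<^sup>2 / \<alpha>1\<^sup>2))"
    proof (rule asymp_equiv_of_tendsto_mult[OF lim])
      show "c \<noteq> 0" using \<gamma> \<Gamma> \<alpha> F by (auto simp: c_def)
    \<comment> \<open>For z > 1 the logarithm is nonzero, so z / ln z cancels the dependence of the
      claimed tail on z.\<close>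
    qed (auto simp: c_def F_def powr_minus intro!: eventually_mono[OF eventually_gt_at_top[of 1]])
  next
    assume n: "-1/2 < n \<and> n < 0"
    define F where "F = hyp2F1 (n + 1) (m + n + 1) (1/2) (\<beta>1\<^sup>2 / \<alpha>1\<^sup>2)"
    have F: "F > 0" unfolding F_def using assms x1 n by (intro hyp2F1_pos) auto
    define c where "c = vg_gamma \<alpha>1 \<beta>1 powr (2 * m + 1) * vg_gamma \<alpha>2 \<beta>2 powr (2 * n + 1)
              / (\<alpha>1 powr (2 * m + 2 * n + 2) * sin (- n * pi))
            * (Gamma (m + n + 1) / (Gamma (m + 1/2) * Gamma (n + 1/2))) * F"
    have sin: "sin (- n * pi) > 0"
    proof (rule sin_gt_zero)
      show "0 < - n * pi" using n by (intro mult_pos_pos) auto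
      have "- n * pi < 1 * pi" using n by (intro mult_strict_right_mono) auto
      then show "- n * pi < pi" by simp
    qed
    \<comment> \<open>Euler's reflection formula at -n, read off from its complex version.
      \<open>Gamma (- n)\<close> stems from the density of Y at 0 and \<open>Gamma (n + 1)\<close>
      from the moment of X of order 2 * n + 1.\<close>
    have reflection: "Gamma (- n) * Gamma (n + 1) = pi / sin (- n * pi)"
    proof -
      have "complex_of_real (Gamma (- n) * Gamma (1 - (- n))) = of_real (pi / sin (pi * (- n)))"
        using Gamma_reflection_complex[of "of_real (- n)"]
        by (simp only: of_real_mult of_real_divide of_real_diff of_real_1
            Gamma_complex_of_real[symmetric] sin_of_real[symmetric])
      then show ?thesis by (simp only: of_real_eq_iff) (simp add: mult.commute add.commute)
    qed
    have "vg_const n \<alpha>2 \<beta>2 * (2 powr (- n - 1) * Gamma (- n) * \<alpha>2 powr n) *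
        (vg_const m \<alpha>1 \<beta>1 * 2 powr (m + (2 * n + 1)) * \<alpha>1 powr (- (m + (2 * n + 1) + 1)) * Gamma ((2 * n + 1 + 1) / 2)
      * Gamma (m + (2 * n + 1 + 1) / 2) * hyp2F1 ((2 * n + 1 + 1) / 2) (m + (2 * n + 1 + 1) / 2) (1/2) (\<beta>1\<^sup>2 / \<alpha>1\<^sup>2)) = c"
      (is "?lhs = _")
    proof -
      have half: "(2 * n + 1 + 1) / 2 = n + 1" by (simp add: field_simps)
      have eqs: "\<alpha>1 powr (2 * m + 2 * n + 2) = \<alpha>1 powr m * \<alpha>1 powr (m + 2 * n + 2)"
        "(2::real) powr (- n - 1) * 2 powr (m + (2 * n + 1)) = 2 powr m * 2 powr n"
        "sqrt pi * sqrt pi = pi"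
        by (simp_all add: powr_add[symmetric] powr_minus[symmetric] field_simps)
      have minus: "\<alpha>1 powr (- (m + (2 * n + 1) + 1)) = 1 / \<alpha>1 powr (m + 2 * n + 2)"
        unfolding powr_minus_divide[symmetric] by (simp add: algebra_simps)
      have "?lhs = vg_gamma \<alpha>1 \<beta>1 powr (2 * m + 1) * vg_gamma \<alpha>2 \<beta>2 powr (2 * n + 1)
          * (2 powr (- n - 1) * 2 powr (m + (2 * n + 1))) * (Gamma (- n) * Gamma (n + 1))
          * Gamma (m + n + 1) * \<alpha>2 powr n * \<alpha>1 powr (- (m + (2 * n + 1) + 1)) * F
          / ((sqrt pi * sqrt pi) * (2 * \<alpha>1) powr m * (2 * \<alpha>2) powr n * Gamma (m + 1/2) * Gamma (n + 1/2))"
        unfolding half vg_const_def F_def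
        by (simp add: add.assoc mult_ac del: real_sqrt_mult_self)
      also have "\<dots> = c"
        unfolding eqs minus reflection c_def using \<alpha> \<Gamma> sin by (simp add: powr_mult mult_ac)
      finally show ?thesis .
    qed
    note lim = tails(3)[OF conjunct2[OF n], unfolded this]
    show "(\<lambda>z. measure M {\<omega> \<in> space M. X \<omega> / Y \<omega> > z}) \<sim>[at_top]
       (\<lambda>z. vg_gamma \<alpha>1 \<beta>1 powr (2 * m + 1) * vg_gamma \<alpha>2 \<beta>2 powr (2 * n + 1)
              / (\<alpha>1 powr (2 * m + 2 * n + 2) * sin (- n * pi))
            * (Gamma (m + n + 1) * z powr (-1 - 2 * n)
                 / ((1 + 2 * n) * Gamma (m + 1/2) * Gamma (n + 1/2)))
            * hyp2F1 (n + 1) (m + n + 1) (1/2) (\<beta>1\<^sup>2 / \<alpha>1\<^sup>2))"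
    proof (rule asymp_equiv_of_tendsto_mult[OF lim])
      have "Gamma (m + n + 1) > 0" using assms n by (intro Gamma_real_pos) linarith
      then show "c \<noteq> 0" using \<gamma> \<Gamma> \<alpha> F sin by (auto simp: c_def)
      \<comment> \<open>The large constants are abstracted to letters, which isolates the
        cancellation of the powers of z and of 1 + 2 * n, nonzero because n > -1/2.\<close>
      have cancel: "(2 * n + 1) * z powr (2 * n + 1) * (A * (B * z powr (-1 - 2 * n) / ((1 + 2 * n) * D * E)) * F) =
          A * (B / (D * E)) * F" if "z > 0" for z A B D E :: real
      proof -
        have "z powr (2 * n + 1) * z powr (-1 - 2 * n) = 1"
          using that by (simp add: powr_add[symmetric])
        then have "(2 * n + 1) * z powr (2 * n + 1) * (A * (B * z powr (-1 - 2 * n) / ((1 + 2 * n) * D * E)) * F) =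
            ((2 * n + 1) / (1 + 2 * n)) * (A * (B / (D * E)) * F)"
          by (simp add: mult_ac)
        moreover have "1 + 2 * n \<noteq> 0" using n by linarith
        then have "(2 * n + 1) / (1 + 2 * n) = 1" by (simp add: add.commute)
        ultimately show ?thesis by (simp only: mult_1_left)
      qed
      show "\<forall>\<^sub>F z in at_top. (2 * n + 1) * z powr (2 * n + 1) *
          (vg_gamma \<alpha>1 \<beta>1 powr (2 * m + 1) * vg_gamma \<alpha>2 \<beta>2 powr (2 * n + 1)
              / (\<alpha>1 powr (2 * m + 2 * n + 2) * sin (- n * pi))
            * (Gamma (m + n + 1) * z powr (-1 - 2 * n)
                 / ((1 + 2 * n) * Gamma (m + 1/2) * Gamma (n + 1/2)))
            * hyp2F1 (n + 1) (m + n + 1) (1/2) (\<beta>1\<^sup>2 / \<alpha>1\<^sup>2)) = c"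
        unfolding c_def F_def
        by (intro eventually_mono[OF eventually_gt_at_top[of 0]] cancel[unfolded F_def])
    qed
  qed
qed

end
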